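(* Let $a,b,c,\mu\in\mathbb{C}$. In each identity below assume that the arguments of the three gamma functions in the numerator on the right-hand side have positive real parts, and that the lower (third) parameters of the hypergeometric functions in the two $w_j$'s occurring are not in $\mathbb{Z}_{\le0}$. (1) For $x\in(0,1)\cup(1,\infty)$: $$\int_{-\infty}^0(-y)^{c-1}w_1(y;a,b,c)(x-y)^{\mu-1}dy=\frac{\Gamma(a-c-\mu+1)\Gamma(b-c-\mu+1)\Gamma(c)}{\Gamma(a+b-c-\mu+1)\Gamma(1-\mu)}\,x^{c+\mu-1}w_5(x;a,b,c+\mu).$$ (2) For $x\in(-\infty,0)\cup(0,1)$: $$\int_1^\infty y^{c-1}w_6(y;a,b,c)(y-x)^{\mu-1}dy=\frac{\Gamma(a-c-\mu+1)\Gamma(b-c-\mu+1)\Gamma(c-a-b+1)}{\Gamma(2-c-\mu)\Gamma(1-\mu)}\,|x|^{c+\mu-1}w_2(x;a,b,c+\mu).$$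
   Context: Write $F(a,b;c;z)={}_2F_1(a,b;c;z)$ for the Gauss hypergeometric function (power series for $|z|<1$, analytically continued to $\mathbb{C}\setminus[1,\infty)$, with $c\notin\mathbb{Z}_{\le0}$). Define $w_1(x;a,b,c)=F(a,b;c;x)$ for $x\in(-\infty,1)$; $w_2(x;a,b,c)=|x|^{1-c}F(a-c+1,b-c+1;2-c;x)$ for $x\in(-\infty,0)\cup(0,1)$; $w_5(x;a,b,c)=F(a,b;a+b-c+1;1-x)$ for $x\in(0,\infty)$; $w_6(x;a,b,c)=|1-x|^{c-a-b}F(c-a,c-b;c-a-b+1;1-x)$ for $x\in(0,1)\cup(1,\infty)$. Convention: $1/\Gamma$ is entire, with value $0$ at nonpositive integers. *)

theory Defs
  imports "HOL-Analysis.Analysis"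
begin

text \<open>
  The function is only meaningful for \<open>c \<notin> \<int>\<^sub>\<le>\<^sub>0\<close> and \<open>z \<notin> [1, \<infinity>)\<close>; there the chosen
  function is determined uniquely by the identity theorem, the slit plane being connected.
\<close>

definition hyp2F1 :: "complex \<Rightarrow> complex \<Rightarrow> complex \<Rightarrow> complex \<Rightarrow> complex" where
  "hyp2F1 a b c =
     (SOME f. f holomorphic_on (- complex_of_real ` {1..}) \<and>
              (\<forall>z\<in>ball 0 1. f z =
                 (\<Sum>n. pochhammer a n * pochhammer b n / (pochhammer c n * fact n) * z ^ n)))"

text \<open>
  Powers of positive reals with complex exponent are principal values (\<open>powr\<close> on
  \<^typ>\<open>complex\<close>). Outside the intervals of definition
  (\<open>x < 1\<close>; \<open>x < 1, x \<noteq> 0\<close>; \<open>x > 0\<close>; \<open>x > 0, x \<noteq> 1\<close>, respectively) the values below are junk.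
\<close>

definition w1 :: "real \<Rightarrow> complex \<Rightarrow> complex \<Rightarrow> complex \<Rightarrow> complex" where
  "w1 x a b c = hyp2F1 a b c (of_real x)"

definition w2 :: "real \<Rightarrow> complex \<Rightarrow> complex \<Rightarrow> complex \<Rightarrow> complex" where
  "w2 x a b c = of_real \<bar>x\<bar> powr (1 - c) * hyp2F1 (a - c + 1) (b - c + 1) (2 - c) (of_real x)"

definition w5 :: "real \<Rightarrow> complex \<Rightarrow> complex \<Rightarrow> complex \<Rightarrow> complex" where
  "w5 x a b c = hyp2F1 a b (a + b - c + 1) (of_real (1 - x))"

definition w6 :: "real \<Rightarrow> complex \<Rightarrow> complex \<Rightarrow> complex \<Rightarrow> complex" where
  "w6 x a b c = of_real \<bar>1 - x\<bar> powr (c - a - b) *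
     hyp2F1 (c - a) (c - b) (c - a - b + 1) (of_real (1 - x))"

end

theory Submission
  imports Defs "HOL-Complex_Analysis.Complex_Analysis" "HOL-Real_Asymp.Real_Asymp"
begin

text \<open>
  With \<open>s = 1 - \<mu>\<close>, both identities are instances of
  \<open>\<integral>\<^sub>0\<^sup>\<infinity> t\<^bsup>c-1\<^esup> F(a, b; c; -t) (x + t)\<^bsup>-s\<^esup> dt = \<Gamma>(c) \<Gamma>(A) \<Gamma>(B) / (\<Gamma>(s) \<Gamma>(C)) F(A, B; C; 1 - x)\<close>, where
  \<open>A = a - c + s\<close>, \<open>B = b - c + s\<close>, \<open>C = a + b - c + s\<close>, combined with Euler's transformation.
  Put \<open>u = t / (1 + t)\<close>. Pfaff's transformation turns the integral into
  \<open>\<integral>\<^sub>0\<^sup>1 u\<^bsup>c-1\<^esup> (1 - u)\<^bsup>A-1\<^esup> F(a, c - b; c; u) (1 - (1 - x) (1 - u))\<^bsup>-s\<^esup> du\<close>. For \<open>\<bar>1 - x\<bar> < 1\<close>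
  expand the last factor in powers of \<open>1 - x\<close>; each coefficient is a beta integral of a hypergeometric
  series, which Gauss's summation theorem evaluates. The integral is holomorphic in \<open>x\<close>, so the
  identity theorem gives all \<open>x > 0\<close>. The same integral also provides the analytic continuation of
  \<open>F(A, B; C; z)\<close> to the slit plane when \<open>A\<close>, \<open>B\<close> have positive real parts.
\<close>

subsection \<open>Gauss summation\<close>

text \<open>This is the reciprocal of Euler's limit for Gamma. Using \<open>rGamma\<close> covers
  nonpositive integers too: there the Pochhammer symbols eventually vanish, and so does the
  limit.\<close>

lemma pochhammer_asymp:
  fixes z :: complex
  shows "(\<lambda>n. pochhammer z n / (fact n * of_nat n powr (z - 1))) \<longlonglongrightarrow> rGamma z"
proof (cases "z \<in> \<int>\<^sub>\<le>\<^sub>0")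
  case True
  then obtain k where k: "z = - of_nat k" by (elim nonpos_Ints_cases')
  have "eventually (\<lambda>n. pochhammer z n / (fact n * of_nat n powr (z - 1)) = 0) sequentially"
    using eventually_gt_at_top[of k]
    by eventually_elim (auto simp: k pochhammer_of_nat_eq_0_iff)
  with True show ?thesis by (simp add: rGamma_nonpos_Int tendsto_eventually)
next
  case False
  have "Gamma_series' z \<longlonglongrightarrow> Gamma z"
    using False by (intro Gamma_series'_LIMSEQ)
  hence "(\<lambda>n. inverse (Gamma_series' z n)) \<longlonglongrightarrow> inverse (Gamma z)"
    using False by (intro tendsto_inverse) (auto simp: Gamma_eq_zero_iff)
  moreover have "eventually (\<lambda>n. inverse (Gamma_series' z n) =
      pochhammer z n / (fact n * of_nat n powr (z - 1))) sequentially"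
    using eventually_gt_at_top[of 0]
  proof eventually_elim
    case (elim n)
    have "of_nat n powr (z - 1) = exp (z * of_real (ln (of_nat n))) / (of_nat n :: complex)"
    proof -
      have "exp (complex_of_real (ln (real n))) = of_nat n"
        using elim by (simp add: exp_of_real)
      thus ?thesis using elim by (simp add: powr_def left_diff_distrib exp_diff)
    qed
    moreover have "(fact n :: complex) = of_nat n * fact (n - 1)"
      using elim by (simp add: fact_reduce)
    ultimately show ?case using elim by (simp add: Gamma_series'_def divide_simps) (simp add: mult_ac)
  qed
  ultimately show ?thesis
    by (simp add: rGamma_inverse_Gamma tendsto_cong)
qed

section \<open>Hypergeometric coefficients and their growth\<close>

definition hyp_coeff :: "complex \<Rightarrow> complex \<Rightarrow> complex \<Rightarrow> nat \<Rightarrow> complex" where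
  "hyp_coeff a b c n = pochhammer a n * pochhammer b n / (pochhammer c n * fact n)"

lemma hyp_coeff_0 [simp]: "hyp_coeff a b c 0 = 1"
  by (simp add: hyp_coeff_def)

lemma hyp_coeff_commute: "hyp_coeff a b c = hyp_coeff b a c"
  by (simp add: hyp_coeff_def fun_eq_iff mult_ac)

lemma pochhammer_neq_0: "(c :: complex) \<notin> \<int>\<^sub>\<le>\<^sub>0 \<Longrightarrow> pochhammer c n \<noteq> 0"
  by (auto dest: pochhammer_eq_0_imp_nonpos_Int)

lemma plus_of_nat_neq_0: "(c :: complex) \<notin> \<int>\<^sub>\<le>\<^sub>0 \<Longrightarrow> c + of_nat n \<noteq> 0"
  by (auto dest: plus_of_nat_eq_0_imp)

lemma Re_pos_notin_nonpos_Ints: "Re z > 0 \<Longrightarrow> z \<notin> \<int>\<^sub>\<le>\<^sub>0"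
  by (auto elim!: nonpos_Ints_cases')

lemma hyp_coeff_Suc:
  assumes "c \<notin> \<int>\<^sub>\<le>\<^sub>0"
  shows "hyp_coeff a b c (Suc n) =
    hyp_coeff a b c n * ((a + of_nat n) * (b + of_nat n) / ((c + of_nat n) * of_nat (Suc n)))"
  using plus_of_nat_neq_0[OF assms, of n] pochhammer_neq_0[OF assms, of n]
  by (simp add: hyp_coeff_def pochhammer_Suc divide_simps)

lemma hyp_coeff_asymp:
  assumes "c \<notin> \<int>\<^sub>\<le>\<^sub>0"
  shows "(\<lambda>n. hyp_coeff a b c n / of_nat n powr (a + b - c - 1)) \<longlonglongrightarrow> rGamma a * rGamma b * Gamma c"
proof -
  let ?p = "\<lambda>z n. pochhammer z n / (fact n * of_nat n powr (z - 1)) :: complex"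
  have "(\<lambda>n. ?p a n * ?p b n / ?p c n) \<longlonglongrightarrow> rGamma a * rGamma b / rGamma c"
    using assms by (intro tendsto_intros pochhammer_asymp) (auto simp: rGamma_eq_zero_iff)
  moreover have "eventually (\<lambda>n. ?p a n * ?p b n / ?p c n =
      hyp_coeff a b c n / of_nat n powr (a + b - c - 1)) sequentially"
    using eventually_gt_at_top[of 0]
  proof eventually_elim
    case (elim n)
    have "of_nat n powr (a + b - c - 1) =
        of_nat n powr (a - 1) * of_nat n powr (b - 1) / (of_nat n powr (c - 1) :: complex)"
      by (simp add: algebra_simps flip: powr_diff powr_add)
    then show ?case using elim pochhammer_neq_0[OF assms, of n]
      by (simp add: hyp_coeff_def divide_simps) (simp add: mult_ac)
  qed
  ultimately show ?thesis by (simp add: tendsto_cong Gamma_def field_class.field_divide_inverse)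
qed

text \<open>A convergent sequence is bounded, so the asymptotics give a power bound. Index 0 is
  excluded because \<open>0 powr e = 0\<close>, whereas the coefficient there is 1.\<close>

lemma hyp_coeff_bound:
  assumes "c \<notin> \<int>\<^sub>\<le>\<^sub>0"
  obtains K where "K > 0" "\<And>n. n > 0 \<Longrightarrow> norm (hyp_coeff a b c n) \<le> K * real n powr (Re (a + b - c) - 1)"
proof -
  from hyp_coeff_asymp[OF assms, of a b] have
    "Bseq (\<lambda>n. hyp_coeff a b c n / of_nat n powr (a + b - c - 1))"
    by (intro convergent_imp_Bseq convergentI)
  then obtain K where K: "K > 0" "\<And>n. norm (hyp_coeff a b c n / of_nat n powr (a + b - c - 1)) \<le> K"
    by (auto elim: BseqE)
  show ?thesis
  proof (rule that[OF K(1)])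
    fix n :: nat assume n: "n > 0"
    have "norm (of_nat n powr (a + b - c - 1) :: complex) = real n powr (Re (a + b - c) - 1)"
      using n norm_powr_real_powr[of "of_nat n" "a + b - c - 1"] by simp
    with K(2)[of n] n show "norm (hyp_coeff a b c n) \<le> K * real n powr (Re (a + b - c) - 1)"
      by (simp add: norm_divide divide_simps mult_ac)
  qed
qed

lemma summable_hyp_coeff:
  assumes "c \<notin> \<int>\<^sub>\<le>\<^sub>0" "Re (c - a - b) > 0"
  shows "summable (\<lambda>n. norm (hyp_coeff a b c n))"
proof -
  obtain K where K: "K > 0" "\<And>n. n > 0 \<Longrightarrow> norm (hyp_coeff a b c n) \<le> K * real n powr (Re (a + b - c) - 1)"
    using hyp_coeff_bound[OF assms(1)] by blast
  show ?thesis
  proof (rule summable_comparison_test_ev)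
    show "eventually (\<lambda>n. norm (norm (hyp_coeff a b c n)) \<le> K * real n powr (Re (a + b - c) - 1)) sequentially"
      using eventually_gt_at_top[of 0] by eventually_elim (use K in auto)
    show "summable (\<lambda>n. K * real n powr (Re (a + b - c) - 1))"
      using assms(2) by (intro summable_mult) (simp add: summable_real_powr_iff)
  qed
qed

text \<open>This removes the boundary term at infinity of the telescoping sum in
  \<open>hyp_coeff_sum_shift\<close>.\<close>

lemma tendsto_of_nat_mult_hyp_coeff:
  assumes "c \<notin> \<int>\<^sub>\<le>\<^sub>0" "Re (c - a - b) > 0"
  shows "(\<lambda>n. of_nat n * hyp_coeff a b c n) \<longlonglongrightarrow> 0"
proof -
  obtain K where K: "K > 0" "\<And>n. n > 0 \<Longrightarrow> norm (hyp_coeff a b c n) \<le> K * real n powr (Re (a + b - c) - 1)"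
    using hyp_coeff_bound[OF assms(1)] by blast
  show ?thesis
  proof (rule Lim_null_comparison)
    show "eventually (\<lambda>n. norm (of_nat n * hyp_coeff a b c n) \<le> K * real n powr (Re (a + b - c))) sequentially"
      using eventually_gt_at_top[of 0]
    proof eventually_elim
      case (elim n)
      have "norm (of_nat n * hyp_coeff a b c n) \<le> real n * (K * real n powr (Re (a + b - c) - 1))"
        using K(2)[OF elim] by (simp add: norm_mult mult_left_mono)
      also have "\<dots> = K * real n powr (Re (a + b - c))"
        using elim by (simp add: powr_diff)
      finally show ?case .
    qed
    have "(\<lambda>n. K * real n powr (Re (a + b - c))) \<longlonglongrightarrow> K * 0"
      using assms(2) by (intro tendsto_intros tendsto_neg_powr filterlim_real_sequentially) auto
    thus "(\<lambda>n. K * real n powr (Re (a + b - c))) \<longlonglongrightarrow> 0" by simp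
  qed
qed

text \<open>The termwise difference of the two sides telescopes.\<close>

lemma hyp_coeff_sum_shift:
  assumes c: "c \<notin> \<int>\<^sub>\<le>\<^sub>0" and re: "Re (c - a - b) > 0"
  shows "c * (c - a - b) * (\<Sum>n. hyp_coeff a b c n) =
         (c - a) * (c - b) * (\<Sum>n. hyp_coeff a b (c + 1) n)"
proof -
  have c1: "c + 1 \<notin> \<int>\<^sub>\<le>\<^sub>0" using c plus_one_in_nonpos_Ints_imp by blast
  let ?t = "hyp_coeff a b c" and ?t' = "hyp_coeff a b (c + 1)"
  have s: "?t sums (\<Sum>n. ?t n)" "?t' sums (\<Sum>n. ?t' n)"
    using summable_hyp_coeff[OF c re] summable_hyp_coeff[OF c1, of a b] re
    by (auto intro!: summable_sums intro: summable_norm_cancel)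
  have eq: "c * (c - a - b) * ?t n - (c - a) * (c - b) * ?t' n =
            c * (of_nat n * ?t n) - c * (of_nat (Suc n) * ?t (Suc n))" for n
  proof -
    have nz: "c + of_nat n \<noteq> 0" "c \<noteq> 0" using plus_of_nat_neq_0[OF c] plus_of_nat_neq_0[OF c, of 0] by auto
    have "c * pochhammer (c + 1) n = pochhammer c n * (c + of_nat n)"
      by (metis pochhammer_Suc pochhammer_rec)
    hence 1: "?t' n = ?t n * (c / (c + of_nat n))"
      using nz pochhammer_neq_0[OF c, of n] pochhammer_neq_0[OF c1, of n]
      by (simp add: hyp_coeff_def divide_simps)
    have 2: "of_nat (Suc n) * ?t (Suc n) = ?t n * ((a + of_nat n) * (b + of_nat n) / (c + of_nat n))"
      using nz by (simp add: hyp_coeff_Suc[OF c] divide_simps del: of_nat_Suc)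
    show ?thesis unfolding 1 2 using nz by (simp add: field_simps)
  qed
  have "(\<lambda>n. c * (of_nat n * ?t n) - c * (of_nat (Suc n) * ?t (Suc n))) sums (c * (of_nat 0 * ?t 0) - c * 0)"
    using tendsto_of_nat_mult_hyp_coeff[OF c re] by (intro telescope_sums' tendsto_intros)
  moreover have "(\<lambda>n. c * (c - a - b) * ?t n - (c - a) * (c - b) * ?t' n) sums
     (c * (c - a - b) * (\<Sum>n. ?t n) - (c - a) * (c - b) * (\<Sum>n. ?t' n))"
    by (intro sums_diff sums_mult s)
  ultimately have "c * (c - a - b) * (\<Sum>n. ?t n) - (c - a) * (c - b) * (\<Sum>n. ?t' n) = 0"
    unfolding eq by (simp add: sums_iff)
  thus ?thesis by simp
qed

text \<open>Iterating \<open>hyp_coeff_sum_shift\<close> relates the sum for \<open>c\<close> to the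
  sum for \<open>c + m\<close> through Pochhammer symbols. As m tends to infinity the shifted sum
  tends to its leading term 1 (Tannery), and the Pochhammer quotient tends to the quotient of Gamma
  values.\<close>

theorem Gauss_hypergeometric_sum:
  assumes c: "Re c > 0" and re: "Re (c - a - b) > 0"
  shows "(\<Sum>n. hyp_coeff a b c n) = Gamma c * Gamma (c - a - b) * rGamma (c - a) * rGamma (c - b)"
proof -
  define S where "S = (\<lambda>m. \<Sum>n. hyp_coeff a b (c + of_nat m) n)"
  have notin: "c + of_nat m \<notin> \<int>\<^sub>\<le>\<^sub>0" "c - a - b + of_nat m \<notin> \<int>\<^sub>\<le>\<^sub>0" for m
    by (rule Re_pos_notin_nonpos_Ints, use c re in simp)+
  have S0: "S 0 * (pochhammer c m * pochhammer (c - a - b) m) =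
      pochhammer (c - a) m * pochhammer (c - b) m * S m" for m
  proof (induction m)
    case (Suc m)
    have "(c + of_nat m) * (c - a - b + of_nat m) * S m =
          (c - a + of_nat m) * (c - b + of_nat m) * S (Suc m)"
      using hyp_coeff_sum_shift[OF notin(1), of m a b] re by (simp add: S_def add_ac algebra_simps)
    with Suc show ?case by (simp add: pochhammer_Suc) algebra
  qed (auto simp: S_def)
  have "((\<lambda>m. \<Sum>n. hyp_coeff a b (c + of_nat m) n) \<longlongrightarrow> (\<Sum>n. if n = 0 then 1 else 0)) sequentially"
  proof (rule tannerys_theorem[THEN conjunct2, THEN conjunct2])
    show "summable (\<lambda>n. norm (hyp_coeff a b c n))"
      using notin(1)[of 0] re by (intro summable_hyp_coeff) auto
    \<comment> \<open>The dominating sequence is the case m = 0. Since \<open>Re c > 0\<close>,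
      adding m moves every factor \<open>c + i\<close> further from the origin, so the denominators
      only grow.\<close>
    have "norm (hyp_coeff a b (c + of_nat m) n) \<le> norm (hyp_coeff a b c n)" for m n
    proof -
      have "norm (pochhammer c n) \<le> norm (pochhammer (c + of_nat m) n)"
        unfolding pochhammer_prod prod_norm[symmetric]
      proof (intro prod_mono conjI norm_ge_zero)
        fix i :: nat
        show "cmod (c + of_nat i) \<le> cmod (c + of_nat m + of_nat i)"
          unfolding cmod_def using c by (intro real_sqrt_le_mono add_mono) (auto intro: power_mono)
      qed
      thus ?thesis using pochhammer_neq_0[OF notin(1), of 0 n] pochhammer_neq_0[OF notin(1), of m n]
        by (auto simp: hyp_coeff_def norm_divide norm_mult intro!: divide_left_mono mult_right_mono)
    qed
    thus "eventually (\<lambda>(n, m). norm (hyp_coeff a b (c + of_nat m) n) \<le> norm (hyp_coeff a b c n))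
            (sequentially \<times>\<^sub>F sequentially)"
      by (auto intro: always_eventually)
    fix n
    show "(\<lambda>m. hyp_coeff a b (c + of_nat m) n) \<longlonglongrightarrow> (if n = 0 then 1 else 0)"
    proof (cases n)
      case (Suc k)
      have inf: "filterlim (\<lambda>m. c + of_nat m + of_nat i) at_infinity sequentially" for i
        by (rule tendsto_add_filterlim_at_infinity'[OF tendsto_add_filterlim_at_infinity[OF tendsto_const tendsto_of_nat] tendsto_const])
      have inv: "(\<lambda>m. inverse (c + of_nat m + of_nat i)) \<longlonglongrightarrow> 0" for i
        using filterlim_compose[OF tendsto_inverse_0 inf] .
      have "(\<lambda>m. pochhammer a n * pochhammer b n / fact n * (\<Prod>i\<in>{0..<n}. inverse (c + of_nat m + of_nat i)))
        \<longlonglongrightarrow> pochhammer a n * pochhammer b n / fact n * (\<Prod>i\<in>{0..<n}. 0)"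
        by (intro tendsto_intros inv)
      thus ?thesis using Suc
        by (simp add: hyp_coeff_def pochhammer_prod prod_inversef[symmetric] comp_def divide_inverse mult_ac)
    qed simp
  qed auto
  hence lim: "S \<longlonglongrightarrow> 1" unfolding S_def by (subst (asm) suminf_finite[of "{0}"]) auto
  let ?p = "\<lambda>z n. pochhammer z n / (fact n * of_nat n powr (z - 1)) :: complex"
  have "(\<lambda>m. ?p (c - a) m * ?p (c - b) m / (?p c m * ?p (c - a - b) m) * S m) \<longlonglongrightarrow>
     rGamma (c - a) * rGamma (c - b) / (rGamma c * rGamma (c - a - b)) * 1"
    using notin[of 0] by (intro tendsto_intros pochhammer_asymp lim) (auto simp: rGamma_eq_zero_iff)
  moreover have "eventually (\<lambda>m. ?p (c - a) m * ?p (c - b) m / (?p c m * ?p (c - a - b) m) * S m = S 0) sequentially"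
    using eventually_gt_at_top[of 0]
  proof eventually_elim
    case (elim n)
    \<comment> \<open>The normalising powers cancel because both exponent sums equal 2c - a - b - 2;
      the quotient is then constant in m by \<open>S0\<close>.\<close>
    have "of_nat n powr (c - a - 1) * of_nat n powr (c - b - 1) =
        of_nat n powr (c - 1) * (of_nat n powr (c - a - b - 1) :: complex)"
      by (simp add: algebra_simps flip: powr_diff powr_add)
    then show ?case using elim pochhammer_neq_0[OF notin(1), of 0 n] pochhammer_neq_0[OF notin(2), of 0 n] S0[of n]
      by (simp add: divide_simps)
  qed
  ultimately have "(\<lambda>m. S 0) \<longlonglongrightarrow> rGamma (c - a) * rGamma (c - b) / (rGamma c * rGamma (c - a - b)) * 1"
    by (simp add: tendsto_cong)
  hence "S 0 = rGamma (c - a) * rGamma (c - b) / (rGamma c * rGamma (c - a - b))"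
    by (simp add: LIMSEQ_const_iff)
  thus ?thesis by (simp add: S_def Gamma_def divide_inverse mult_ac)
qed

subsection \<open>Beta integrals of hypergeometric series\<close>

lemma summable_hyp_coeff_power:
  assumes c: "c \<notin> \<int>\<^sub>\<le>\<^sub>0" and z: "norm (z :: complex) < 1"
  shows "summable (\<lambda>n. norm (hyp_coeff a b c n * z ^ n))"
proof (cases "z = 0")
  case False
  obtain K where K: "K > 0" "\<And>n. n > 0 \<Longrightarrow> norm (hyp_coeff a b c n) \<le> K * real n powr (Re (a + b - c) - 1)"
    using hyp_coeff_bound[OF c] by blast
  define e r where "e = Re (a + b - c) - 1" and "r = norm z"
  have r: "0 < r" "r < 1" using z False by (auto simp: r_def)
  show ?thesis
  proof (rule summable_comparison_test_ev)
    show "eventually (\<lambda>n. norm (norm (hyp_coeff a b c n * z ^ n)) \<le> K * (real n powr e * r ^ n)) sequentially"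
      using eventually_gt_at_top[of 0]
      by eventually_elim (use K r in \<open>auto simp: norm_mult norm_power e_def r_def mult_ac intro!: mult_left_mono\<close>)
    have "(\<lambda>n. real n powr e * r ^ n) \<in> O(\<lambda>n. real n powr (-2))"
      using r by real_asymp
    hence "summable (\<lambda>n. real n powr e * r ^ n)"
      by (rule summable_comparison_test_bigo[rotated]) (simp add: summable_real_powr_iff)
    thus "summable (\<lambda>n. K * (real n powr e * r ^ n))" by (rule summable_mult)
  qed
next
  case True
  show ?thesis
    by (rule summable_finite[of "{0}"]) (use True in auto)
qed

text \<open>Reading binomial coefficients as hypergeometric ones makes the growth bounds above
  available for the binomial series.\<close>

lemma pochhammer_over_fact: "pochhammer s n / fact n = hyp_coeff s 1 1 n"
  by (simp add: hyp_coeff_def flip: pochhammer_fact)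

lemma one_notin_nonpos_Ints: "(1 :: complex) \<notin> \<int>\<^sub>\<le>\<^sub>0"
  by (rule Re_pos_notin_nonpos_Ints) simp

lemma binomial_series_pochhammer:
  assumes "norm (z :: complex) < 1"
  shows "(\<lambda>n. pochhammer s n / fact n * z ^ n) sums (1 - z) powr (- s)"
    and "summable (\<lambda>n. norm (pochhammer s n / fact n * z ^ n))"
proof -
  have "(\<lambda>n. (- s gchoose n) * (- z) ^ n) sums (1 + (- z)) powr (- s)"
    by (rule gen_binomial_complex) (use assms in simp)
  moreover have "(- s gchoose n) * (- z) ^ n = pochhammer s n / fact n * z ^ n" for n
    by (simp add: gbinomial_pochhammer power_minus[of z])
  ultimately show "(\<lambda>n. pochhammer s n / fact n * z ^ n) sums (1 - z) powr (- s)" by simp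
  show "summable (\<lambda>n. norm (pochhammer s n / fact n * z ^ n))"
    unfolding pochhammer_over_fact by (rule summable_hyp_coeff_power[OF one_notin_nonpos_Ints assms])
qed

lemma of_real_powr_plus_of_nat:
  assumes "x > 0"
  shows "complex_of_real x powr (p + of_nat n) = of_real x powr p * of_real x ^ n"
  using assms by (simp add: powr_add powr_nat')

text \<open>Sum and integral are exchanged under summability of the L1 norms. Stating it with
  \<open>has_bochner_integral\<close> carries integrability and the value of the integral
  together.\<close>

lemma has_bochner_integral_suminf:
  fixes f :: "nat \<Rightarrow> 'a \<Rightarrow> complex"
  assumes "\<And>n. has_bochner_integral M (f n) (s n)"
    and "summable (\<lambda>n. \<integral>x. norm (f n x) \<partial>M)"
    and "AE x in M. summable (\<lambda>n. norm (f n x)) \<and> (\<lambda>n. f n x) sums F x"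
    and F: "F \<in> borel_measurable M"
  shows "has_bochner_integral M F (\<Sum>n. s n)" "summable s"
proof -
  have i: "integrable M (f n)" "integral\<^sup>L M (f n) = s n" for n
    using assms(1)[of n] by (auto simp: has_bochner_integral_iff)
  have ae: "AE x in M. summable (\<lambda>n. norm (f n x))" using assms(3) by auto
  have eq: "AE x in M. (\<Sum>n. f n x) = F x"
    using assms(3) by eventually_elim (auto simp: sums_iff)
  have *: "integrable M (\<lambda>x. \<Sum>n. f n x)" "(\<integral>x. (\<Sum>n. f n x) \<partial>M) = (\<Sum>n. s n)"
    using integrable_suminf[OF i(1) ae assms(2)] integral_suminf[OF i(1) ae assms(2)] i(2) by auto
  show "summable s" using summable_integral[OF i(1) ae assms(2)] i(2) by simp
  have [measurable]: "(\<lambda>x. \<Sum>n. f n x) \<in> borel_measurable M"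
    using * by simp
  show "has_bochner_integral M F (\<Sum>n. s n)"
    using * integrable_cong_AE[OF _ F eq] integral_cong_AE[OF _ F eq]
    by (auto simp: has_bochner_integral_iff)
qed

text \<open>
  The variable \<open>u\<close> is uniformly distributed on \<open>(0, 1)\<close>; the moments are the only information
  about its law that is needed, and they avoid a change of variables.
\<close>

locale unit_uniform =
  fixes M :: "'a measure" and u :: "'a \<Rightarrow> real"
  assumes u_measurable [measurable]: "u \<in> borel_measurable M"
    and u_bounds: "AE t in M. 0 < u t \<and> u t < 1"
    and moment: "Re p > 0 \<Longrightarrow> has_bochner_integral M (\<lambda>t. of_real (u t) powr (p - 1)) (1 / p)"
begin

text \<open>The norm of a product of complex powers of positive reals is the same product with the
  exponents replaced by their real parts. A complex moment formula therefore also evaluates L1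
  norms, without a separate real version.\<close>

lemma integral_norm_eq:
  assumes "AE t in M. complex_of_real (norm (f t)) = g t" and g: "has_bochner_integral M g s"
    and f: "f \<in> borel_measurable M"
  shows "(\<integral>t. norm (f t :: complex) \<partial>M) = norm s"
proof -
  have "complex_of_real (\<integral>t. norm (f t) \<partial>M) = (\<integral>t. complex_of_real (norm (f t)) \<partial>M)"
    by (rule integral_complex_of_real[symmetric])
  also have "\<dots> = s"
    using assms by (subst integral_cong_AE[of _ _ g]) (auto simp: has_bochner_integral_iff)
  finally have "s = complex_of_real (\<integral>t. norm (f t) \<partial>M)" ..
  thus ?thesis by simp
qed

text \<open>Expanding the factor \<open>1 - u\<close> in its binomial series leaves only moments,
  each 1 / (p + n). The resulting series is F(1 - q, p; p + 1; 1) / p, which Gauss summation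
  evaluates because its parameter excess is q.\<close>

lemma beta:
  assumes p: "Re p > 0" and q: "Re q > 0"
  shows "has_bochner_integral M (\<lambda>t. of_real (u t) powr (p - 1) * of_real (1 - u t) powr (q - 1))
           (Gamma p * Gamma q * rGamma (p + q))"
proof -
  define k where "k = (\<lambda>n. pochhammer (1 - q) n / fact n :: complex)"
  define f where "f = (\<lambda>n t. k n * of_real (u t) powr (p + of_nat n - 1))"
  \<comment> \<open>Here 1 / (r + n) is written as (r)_n / (r (r + 1)_n). The identity is used with
    r = p for the value and with r = Re p for the L1 norms.\<close>
  have ratio: "k n / (r + of_nat n) = hyp_coeff (1 - q) r (r + 1) n / r" if "Re r > 0" for r n
  proof -
    have "r \<notin> \<int>\<^sub>\<le>\<^sub>0" "r + 1 \<notin> \<int>\<^sub>\<le>\<^sub>0" by (rule Re_pos_notin_nonpos_Ints, use that in simp)+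
    moreover have "r * pochhammer (r + 1) n = pochhammer r n * (r + of_nat n)"
      by (metis pochhammer_Suc pochhammer_rec)
    ultimately show ?thesis
      using pochhammer_neq_0[of "r + 1" n] plus_of_nat_neq_0[of r n] plus_of_nat_neq_0[of r 0]
      by (simp add: k_def hyp_coeff_def divide_simps) (simp add: mult_ac)
  qed
  define s where "s = (\<lambda>n. k n / (p + of_nat n))"
  have f: "has_bochner_integral M (f n) (s n)" for n
    using moment[of "p + of_nat n"] p unfolding f_def s_def
    by (auto intro!: has_bochner_integral_mult_right simp: divide_inverse)
  define r where "r = complex_of_real (Re p)"
  have r: "Re r > 0" "r \<notin> \<int>\<^sub>\<le>\<^sub>0" "r + 1 \<notin> \<int>\<^sub>\<le>\<^sub>0" using p by (auto simp: r_def intro!: Re_pos_notin_nonpos_Ints)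
  have "(\<integral>t. norm (f n t) \<partial>M) = norm (hyp_coeff (1 - q) r (r + 1) n / r)" for n
  proof -
    have "(\<integral>t. norm (f n t) \<partial>M) = norm (norm (k n) * (1 / (r + of_nat n)))"
    proof (rule integral_norm_eq)
      show "has_bochner_integral M (\<lambda>t. norm (k n) * of_real (u t) powr (r + of_nat n - 1)) (norm (k n) * (1 / (r + of_nat n)))"
        using moment[of "r + of_nat n"] r by (intro has_bochner_integral_mult_right) auto
      show "AE t in M. complex_of_real (norm (f n t)) = complex_of_real (norm (k n)) * of_real (u t) powr (r + of_nat n - 1)"
        using u_bounds
      proof eventually_elim
        case (elim t)
        thus ?case by (simp add: f_def norm_mult norm_powr_real_powr r_def powr_of_real[symmetric])
      qed
      show "f n \<in> borel_measurable M" unfolding f_def by measurable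
    qed
    also have "\<dots> = norm (k n / (r + of_nat n))" by (simp add: norm_mult norm_divide)
    also have "k n / (r + of_nat n) = hyp_coeff (1 - q) r (r + 1) n / r" by (rule ratio) fact
    finally show ?thesis .
  qed
  moreover have "summable (\<lambda>n. norm (hyp_coeff (1 - q) r (r + 1) n / r))"
    unfolding norm_divide using q r by (intro summable_divide summable_hyp_coeff) auto
  ultimately have sm: "summable (\<lambda>n. \<integral>t. norm (f n t) \<partial>M)" by simp
  have "AE t in M. summable (\<lambda>n. norm (f n t)) \<and>
      (\<lambda>n. f n t) sums (of_real (u t) powr (p - 1) * of_real (1 - u t) powr (q - 1))"
    using u_bounds
  proof eventually_elim
    case (elim t)
    have f_eq: "f n t = of_real (u t) powr (p - 1) * (pochhammer (1 - q) n / fact n * of_real (u t) ^ n)" for n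
      using of_real_powr_plus_of_nat[of "u t" "p - 1" n] elim by (simp add: f_def k_def algebra_simps)
    have "norm (complex_of_real (u t)) < 1" using elim by simp
    note b = binomial_series_pochhammer[OF this, of "1 - q"]
    show ?case unfolding f_eq norm_mult[of "of_real (u t) powr (p - 1)"]
      using sums_mult[OF b(1), of "of_real (u t) powr (p - 1)"] summable_mult[OF b(2)] by simp
  qed
  note main = has_bochner_integral_suminf[OF f sm this]
  have "(\<Sum>n. s n) = (\<Sum>n. hyp_coeff (1 - q) p (p + 1) n / p)"
    unfolding s_def by (intro suminf_cong ratio p)
  also have "\<dots> = (\<Sum>n. hyp_coeff (1 - q) p (p + 1) n) / p"
    using p q by (intro suminf_divide summable_norm_cancel[OF summable_hyp_coeff] Re_pos_notin_nonpos_Ints) auto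
  also have "\<dots> = (Gamma (p + 1) / p) * Gamma q * rGamma (p + q)"
    using p q by (subst Gauss_hypergeometric_sum) (auto simp: algebra_simps)
  also have "Gamma (p + 1) / p = Gamma p"
    using p Re_pos_notin_nonpos_Ints[of p] by (subst Gamma_plus1) auto
  finally show ?thesis using main(1) by simp
qed

text \<open>Integrating termwise multiplies the n-th coefficient by Beta(c + n, q) = Beta(c, q)
  (c)_n / (c + q)_n. This replaces the lower parameter c by c + q, and Gauss summation applies to
  F(a, b; c + q; 1).\<close>

lemma hypergeometric_beta:
  assumes c: "Re c > 0" and q: "Re q > 0" and re: "Re (c + q - a - b) > 0"
  shows "has_bochner_integral M
           (\<lambda>t. of_real (u t) powr (c - 1) * of_real (1 - u t) powr (q - 1) * (\<Sum>n. hyp_coeff a b c n * of_real (u t) ^ n))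
           (Gamma c * Gamma q * Gamma (c + q - a - b) * rGamma (c + q - a) * rGamma (c + q - b))"
proof -
  note notin = Re_pos_notin_nonpos_Ints
  have cn: "c \<notin> \<int>\<^sub>\<le>\<^sub>0" and cqn: "c + q \<notin> \<int>\<^sub>\<le>\<^sub>0" using c q by (auto intro!: notin)
  define f where "f = (\<lambda>n t. hyp_coeff a b c n * (of_real (u t) powr (c + of_nat n - 1) * of_real (1 - u t) powr (q - 1)))"
  define B where "B = (\<lambda>p q. Gamma p * Gamma q * rGamma (p + q) :: complex)"
  have B_shift: "B (p + of_nat n) q = B p q * (pochhammer p n / pochhammer (p + q) n)"
    if "Re p > 0" "Re q > 0" for p q n
  proof -
    have pn: "p \<notin> \<int>\<^sub>\<le>\<^sub>0" and pqn: "p + q \<notin> \<int>\<^sub>\<le>\<^sub>0" using that by (auto intro!: notin)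
    have "Gamma (p + of_nat n) = Gamma p * pochhammer p n"
      using pn by (subst pochhammer_Gamma) (auto simp: Gamma_eq_zero_iff)
    moreover have "rGamma (p + q + of_nat n) = rGamma (p + q) / pochhammer (p + q) n"
      using pochhammer_rGamma[of "p + q" n] pochhammer_neq_0[OF pqn, of n] by (simp add: field_simps)
    ultimately show ?thesis by (simp add: B_def add_ac)
  qed
  define s where "s = (\<lambda>n. hyp_coeff a b c n * B (c + of_nat n) q)"
  have s_eq: "s n = B c q * hyp_coeff a b (c + q) n" for n
    using pochhammer_neq_0[OF cn, of n] by (simp add: s_def B_shift c q hyp_coeff_def field_simps)
  have f: "has_bochner_integral M (f n) (s n)" for n
    using beta[of "c + of_nat n" q] c q unfolding f_def s_def B_def
    by (intro has_bochner_integral_mult_right) auto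
  define rc rq where "rc = complex_of_real (Re c)" and "rq = complex_of_real (Re q)"
  have r: "Re rc > 0" "Re rq > 0" "rc \<notin> \<int>\<^sub>\<le>\<^sub>0" "rc + rq \<notin> \<int>\<^sub>\<le>\<^sub>0" using c q by (auto simp: rc_def rq_def intro!: notin)
  have int_norm: "(\<integral>t. norm (f n t) \<partial>M) = norm (B rc rq) * (norm (hyp_coeff a b c n) * norm (hyp_coeff rc 1 (rc + rq) n))" for n
  proof -
    have "(\<integral>t. norm (f n t) \<partial>M) = norm (norm (hyp_coeff a b c n) * B (rc + of_nat n) rq)"
    proof (rule integral_norm_eq)
      show "has_bochner_integral M (\<lambda>t. norm (hyp_coeff a b c n) * (of_real (u t) powr (rc + of_nat n - 1) * of_real (1 - u t) powr (rq - 1)))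
             (norm (hyp_coeff a b c n) * B (rc + of_nat n) rq)"
        using beta[of "rc + of_nat n" rq] r unfolding B_def by (intro has_bochner_integral_mult_right) auto
      show "AE t in M. complex_of_real (norm (f n t)) =
              norm (hyp_coeff a b c n) * (of_real (u t) powr (rc + of_nat n - 1) * of_real (1 - u t) powr (rq - 1))"
        using u_bounds
      proof eventually_elim
        case (elim t)
        have "complex_of_real (norm (complex_of_real x powr y)) = of_real x powr (of_real (Re y))" if "x > 0" for x y
          using that by (simp add: norm_powr_real_powr powr_of_real[symmetric])
        from this[of "u t"] this[of "1 - u t"] elim show ?case by (simp add: f_def norm_mult rc_def rq_def)
      qed
      show "f n \<in> borel_measurable M" unfolding f_def by measurable
    qed
    also have "\<dots> = norm (B rc rq) * (norm (hyp_coeff a b c n) * norm (pochhammer rc n / pochhammer (rc + rq) n))"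
      using r by (simp add: norm_mult norm_divide B_shift)
    \<comment> \<open>Viewed as a hypergeometric coefficient, this quotient is bounded by a multiple
      of n^(-Re q). With the bound for the other factor, the L1 norms are of order n^(Re(a + b - c -
      q) - 1), which is summable by \<open>re\<close>.\<close>
    also have "pochhammer rc n / pochhammer (rc + rq) n = hyp_coeff rc 1 (rc + rq) n"
      by (simp add: hyp_coeff_def flip: pochhammer_fact)
    finally show ?thesis .
  qed
  have sm: "summable (\<lambda>n. \<integral>t. norm (f n t) \<partial>M)"
    unfolding int_norm
  proof (rule summable_mult)
    obtain K1 where K1: "K1 > 0" "\<And>n. n > 0 \<Longrightarrow> norm (hyp_coeff a b c n) \<le> K1 * real n powr (Re (a + b - c) - 1)"
      using hyp_coeff_bound[OF cn] by blast
    obtain K2 where K2: "K2 > 0" "\<And>n. n > 0 \<Longrightarrow> norm (hyp_coeff rc 1 (rc + rq) n) \<le> K2 * real n powr (Re (rc + 1 - (rc + rq)) - 1)"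
      using hyp_coeff_bound[OF r(4)] by blast
    show "summable (\<lambda>n. norm (hyp_coeff a b c n) * norm (hyp_coeff rc 1 (rc + rq) n))"
    proof (rule summable_comparison_test_ev)
      show "eventually (\<lambda>n. norm (norm (hyp_coeff a b c n) * norm (hyp_coeff rc 1 (rc + rq) n)) \<le>
        K1 * K2 * real n powr (Re (a + b - c - q) - 1)) sequentially"
        using eventually_gt_at_top[of 0]
      proof eventually_elim
        case (elim n)
        have "norm (hyp_coeff a b c n) * norm (hyp_coeff rc 1 (rc + rq) n) \<le>
          (K1 * real n powr (Re (a + b - c) - 1)) * (K2 * real n powr (Re (rc + 1 - (rc + rq)) - 1))"
          using K1 K2 elim by (intro mult_mono) auto
        also have "\<dots> = K1 * K2 * real n powr (Re (a + b - c - q) - 1)"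
          by (simp add: rq_def algebra_simps flip: powr_add)
        finally show ?case by simp
      qed
      show "summable (\<lambda>n. K1 * K2 * real n powr (Re (a + b - c - q) - 1))"
        using re by (intro summable_mult) (simp add: summable_real_powr_iff)
    qed
  qed
  define F where "F = (\<lambda>t. of_real (u t) powr (c - 1) * of_real (1 - u t) powr (q - 1) * (\<Sum>n. hyp_coeff a b c n * of_real (u t) ^ n))"
  have ae: "AE t in M. summable (\<lambda>n. norm (f n t)) \<and> (\<lambda>n. f n t) sums F t"
    using u_bounds
  proof eventually_elim
    case (elim t)
    have f_eq: "f n t = of_real (u t) powr (c - 1) * of_real (1 - u t) powr (q - 1) * (hyp_coeff a b c n * of_real (u t) ^ n)" for n
      using of_real_powr_plus_of_nat[of "u t" "c - 1" n] elim by (simp add: f_def algebra_simps)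
    have "norm (complex_of_real (u t)) < 1" using elim by simp
    note b = summable_hyp_coeff_power[OF cn this, of a b]
    have b': "(\<lambda>n. hyp_coeff a b c n * of_real (u t) ^ n) sums (\<Sum>n. hyp_coeff a b c n * of_real (u t) ^ n)"
      by (rule summable_sums[OF summable_norm_cancel[OF b]])
    show ?case unfolding f_eq F_def norm_mult[of "of_real (u t) powr (c - 1) * of_real (1 - u t) powr (q - 1)"]
      using sums_mult[OF b'] summable_mult[OF b] by blast
  qed
  have [measurable]: "F \<in> borel_measurable M"
    unfolding F_def by measurable
  have "has_bochner_integral M F (\<Sum>n. s n)"
    by (rule has_bochner_integral_suminf[OF f sm ae]) simp
  also have "(\<Sum>n. s n) = B c q * (\<Sum>n. hyp_coeff a b (c + q) n)"
    unfolding s_eq using cqn re by (intro suminf_mult summable_norm_cancel[OF summable_hyp_coeff]) auto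
  also have "\<dots> = B c q * (Gamma (c + q) * Gamma (c + q - a - b) * rGamma (c + q - a) * rGamma (c + q - b))"
    using c q re by (subst Gauss_hypergeometric_sum) auto
  also have "\<dots> = Gamma c * Gamma q * Gamma (c + q - a - b) * rGamma (c + q - a) * rGamma (c + q - b)"
    using cqn by (simp add: B_def Gamma_def rGamma_eq_zero_iff)
  finally show ?thesis unfolding F_def .
qed

end

subsection \<open>Integrals holomorphic on the slit plane\<close>

definition slit_plane :: "complex set" where
  "slit_plane = - complex_of_real ` {1..}"

lemma of_real_in_slit_plane: "r < 1 \<Longrightarrow> complex_of_real r \<in> slit_plane"
  by (auto simp: slit_plane_def)

lemma slit_plane_iff: "z \<in> slit_plane \<longleftrightarrow> 1 - z \<notin> \<real>\<^sub>\<le>\<^sub>0"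
proof -
  have "z \<in> complex_of_real ` {1..} \<longleftrightarrow> 1 - z \<in> \<real>\<^sub>\<le>\<^sub>0"
    unfolding complex_nonpos_Reals_iff by (auto simp: complex_eq_iff image_iff intro!: bexI[of _ "Re z"])
  thus ?thesis by (auto simp: slit_plane_def)
qed

lemma open_slit_plane: "open slit_plane"
proof -
  have "slit_plane = (\<lambda>z. 1 - z) -` (- \<real>\<^sub>\<le>\<^sub>0)" by (auto simp: slit_plane_iff)
  moreover have "open ((\<lambda>z. 1 - z) -` (- \<real>\<^sub>\<le>\<^sub>0 :: complex set))"
    by (intro open_vimage open_Compl closed_nonpos_Reals_complex continuous_intros)
  ultimately show ?thesis by metis
qed

text \<open>The slit plane is star-shaped about 0. Hence 1 - z s stays off the branch cut of the
  principal power for every s in [0, 1], which makes the integral kernel holomorphic in z.\<close>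

lemma slit_plane_scaleR:
  assumes "z \<in> slit_plane" "0 \<le> s" "s \<le> 1"
  shows "1 - z * of_real s \<notin> \<real>\<^sub>\<le>\<^sub>0"
proof
  assume "1 - z * of_real s \<in> \<real>\<^sub>\<le>\<^sub>0"
  hence *: "1 \<le> Re z * s" "Im z * s = 0" by (auto simp: complex_nonpos_Reals_iff)
  hence "s \<noteq> 0" by auto
  hence "Im z = 0" "s > 0" using * assms by auto
  moreover have "Re z \<ge> 1"
    using * assms by (smt (verit) mult_left_le mult_nonpos_nonneg)
  ultimately show False using assms by (auto simp: slit_plane_iff complex_nonpos_Reals_iff)
qed

lemma connected_slit_plane: "connected slit_plane"
proof -
  have "closed_segment 0 z \<subseteq> slit_plane" if "z \<in> slit_plane" for z
    using slit_plane_scaleR[OF that] by (auto simp: closed_segment_def slit_plane_iff scaleR_conv_of_real mult.commute)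
  moreover have "0 \<in> slit_plane" by (auto simp: slit_plane_iff)
  ultimately have "starlike slit_plane" unfolding starlike_def by blast
  thus ?thesis by (rule starlike_imp_connected)
qed

lemma ball_subset_slit_plane: "ball 0 1 \<subseteq> slit_plane"
  by (auto simp: slit_plane_def)

text \<open>Identity theorem on the connected slit plane. The radius is left free because Pfaff's
  transformation is first checked only on a small disc.\<close>

lemma holomorphic_on_slit_plane_eqI:
  assumes "f holomorphic_on slit_plane" "g holomorphic_on slit_plane" "e > 0"
    and "\<And>z. norm z < e \<Longrightarrow> f z = g z" and "z \<in> slit_plane"
  shows "f z = g z"
proof (rule analytic_continuation_open[of "ball 0 (min 1 e)" slit_plane f g])
  show "ball 0 (min 1 e) \<subseteq> slit_plane" using ball_subset_slit_plane by auto
  show "f w = g w" if "w \<in> ball 0 (min 1 e)" for w using that assms(4) by simp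
  show "ball (0 :: complex) (min 1 e) \<noteq> {}" using assms(3) by (simp add: not_le)
qed (use assms open_slit_plane connected_slit_plane in auto)

text \<open>The kernel is continuous on the compact product of a closed disc with [0, 1], so it is
  bounded there, locally uniformly in z.\<close>

lemma slit_plane_kernel_bound:
  assumes "z0 \<in> slit_plane"
  shows "\<exists>r>0. \<exists>K>0. cball z0 r \<subseteq> slit_plane \<and>
           (\<forall>z\<in>cball z0 r. \<forall>s\<in>{0..1::real}. norm ((1 - z * of_real s) powr a) \<le> K)"
proof -
  obtain r where r: "r > 0" "cball z0 r \<subseteq> slit_plane"
    using open_contains_cball open_slit_plane assms by blast
  have "continuous_on (cball z0 r \<times> {0..1}) (\<lambda>x. (1 - fst x * of_real (snd x)) powr a)"
  proof (subst continuous_on_cong[OF refl])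
    show "(1 - fst x * of_real (snd x)) powr a = exp (a * Ln (1 - fst x * of_real (snd x)))"
      if "x \<in> cball z0 r \<times> {0..1}" for x
      using that r slit_plane_scaleR[of "fst x" "snd x"] by (auto simp: powr_def)
    show "continuous_on (cball z0 r \<times> {0..1}) (\<lambda>x. exp (a * Ln (1 - fst x * of_real (snd x))))"
      using r slit_plane_scaleR by (intro continuous_intros) (auto simp del: complex_nonpos_Reals_iff)
  qed
  hence "compact ((\<lambda>x. (1 - fst x * of_real (snd x)) powr a) ` (cball z0 r \<times> {0..1}))"
    by (intro compact_continuous_image compact_Times) auto
  from compact_imp_bounded[OF this] obtain K where K: "K > 0"
    "\<forall>y \<in> (\<lambda>x. (1 - fst x * of_real (snd x)) powr a) ` (cball z0 r \<times> {0..1}). norm y \<le> K"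
    unfolding bounded_pos by blast
  hence "norm ((1 - z * of_real s) powr a) \<le> K" if "z \<in> cball z0 r" "s \<in> {0..1}" for z s
    using that by (force dest: bspec[of _ _ "(1 - z * of_real s) powr a"])
  with r K(1) show ?thesis by blast
qed

lemma integrable_slit_kernel:
  fixes g :: "'a \<Rightarrow> complex" and v :: "'a \<Rightarrow> real"
  assumes g: "integrable M g" and v [measurable]: "v \<in> borel_measurable M"
    and v01: "AE t in M. 0 \<le> v t \<and> v t \<le> 1" and z: "z \<in> slit_plane"
  shows "integrable M (\<lambda>t. g t * (1 - z * of_real (v t)) powr a)"
proof -
  obtain r K where rK: "r > 0" "cball z r \<subseteq> slit_plane" "K > 0"
    "\<forall>z'\<in>cball z r. \<forall>s\<in>{0..1}. norm ((1 - z' * of_real s) powr a) \<le> K"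
    using slit_plane_kernel_bound[OF z, of a] by blast
  have [measurable]: "g \<in> borel_measurable M" using g by simp
  show ?thesis
  proof (rule Bochner_Integration.integrable_bound)
    show "integrable M (\<lambda>t. K * norm (g t))" using g by (intro integrable_mult_right integrable_norm)
    show "AE t in M. norm (g t * (1 - z * of_real (v t)) powr a) \<le> norm (K * norm (g t))"
      using v01
    proof eventually_elim
      case (elim t)
      hence "norm ((1 - z * of_real (v t)) powr a) \<le> K" using rK by auto
      from mult_left_mono[OF this, of "norm (g t)"] show ?case using rK(3) by (simp add: norm_mult mult.commute)
    qed
  qed measurable
qed

text \<open>Differentiation under the integral sign: a derivative bound uniform in s dominates the
  difference quotients, and dominated convergence gives the derivative.\<close>

lemma holomorphic_slit_kernel_integral:
  fixes g :: "'a \<Rightarrow> complex" and v :: "'a \<Rightarrow> real"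
  assumes g: "integrable M g" and v [measurable]: "v \<in> borel_measurable M"
    and v01: "AE t in M. 0 \<le> v t \<and> v t \<le> 1"
  shows "(\<lambda>z. \<integral>t. g t * (1 - z * of_real (v t)) powr a \<partial>M) holomorphic_on slit_plane"
    (is "?I holomorphic_on _")
proof -
  have [measurable]: "g \<in> borel_measurable M" using g by simp
  let ?D = "\<lambda>z s. - (a * (1 - z * of_real s) powr (a - 1) * of_real s)"
  have deriv: "((\<lambda>z. (1 - z * of_real s) powr a) has_field_derivative ?D z s) (at z)"
    if "z \<in> slit_plane" "0 \<le> s" "s \<le> 1" for z s
    using slit_plane_scaleR[OF that] by (auto intro!: derivative_eq_intros)
  have "(?I has_field_derivative (\<integral>t. g t * ?D z (v t) \<partial>M)) (at z)" if z: "z \<in> slit_plane" for z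
  proof -
    obtain r K where rK: "r > 0" "cball z r \<subseteq> slit_plane" "K > 0"
      "\<forall>z'\<in>cball z r. \<forall>s\<in>{0..1}. norm ((1 - z' * of_real s) powr (a - 1)) \<le> K"
      using slit_plane_kernel_bound[OF z, of "a - 1"] by blast
    \<comment> \<open>Mean value inequality on the disc \<open>cball z r\<close>, which is
      convex.\<close>
    have bound: "norm ((1 - w * of_real s) powr a - (1 - z * of_real s) powr a) \<le> norm a * K * norm (w - z)"
      if "w \<in> cball z r" "0 \<le> s" "s \<le> 1" for w s
    proof (rule field_differentiable_bound[of "cball z r" "\<lambda>z. (1 - z * of_real s) powr a" "\<lambda>z. ?D z s"])
      show "((\<lambda>z. (1 - z * of_real s) powr a) has_field_derivative ?D z' s) (at z' within cball z r)" if "z' \<in> cball z r" for z'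
        using that \<open>0 \<le> s\<close> \<open>s \<le> 1\<close> rK(2) by (intro has_field_derivative_at_within[OF deriv]) auto
      show "norm (?D z' s) \<le> norm a * K" if "z' \<in> cball z r" for z'
      proof -
        have "norm (?D z' s) = norm a * norm ((1 - z' * of_real s) powr (a - 1)) * \<bar>s\<bar>" by (simp add: norm_mult)
        also have "\<dots> \<le> norm a * K * 1" using rK(3,4) that \<open>0 \<le> s\<close> \<open>s \<le> 1\<close>
          by (intro mult_mono) auto
        finally show ?thesis by simp
      qed
    qed (use that rK in auto)
    show ?thesis
      unfolding has_field_derivative_iff tendsto_at_iff_sequentially comp_def
    proof safe
      fix X :: "nat \<Rightarrow> complex" assume X: "\<forall>i. X i \<in> UNIV - {z}" "X \<longlonglongrightarrow> z"
      from X(2) rK(1) obtain N where N: "\<And>n. n \<ge> N \<Longrightarrow> dist (X n) z < r"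
        by (auto simp: lim_sequentially)
      \<comment> \<open>Dropping the first N terms keeps the whole sequence inside the disc, so the
        domination holds for every index.\<close>
      define Y where "Y = (\<lambda>n. X (n + N))"
      have Y: "Y \<longlonglongrightarrow> z" "\<And>n. Y n \<noteq> z" "\<And>n. Y n \<in> cball z r"
        using X N by (auto simp: Y_def dist_commute intro!: LIMSEQ_ignore_initial_segment less_imp_le)
      let ?q = "\<lambda>n t. g t * (((1 - Y n * of_real (v t)) powr a - (1 - z * of_real (v t)) powr a) / (Y n - z))"
      have "(\<lambda>n. \<integral>t. ?q n t \<partial>M) \<longlonglongrightarrow> (\<integral>t. g t * ?D z (v t) \<partial>M)"
      proof (rule integral_dominated_convergence)
        show "integrable M (\<lambda>t. norm a * K * norm (g t))" using g by (intro integrable_mult_right integrable_norm)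
        show "AE t in M. (\<lambda>n. ?q n t) \<longlonglongrightarrow> g t * ?D z (v t)"
          using v01
        proof eventually_elim
          case (elim t)
          have "((\<lambda>w. ((1 - w * of_real (v t)) powr a - (1 - z * of_real (v t)) powr a) / (w - z)) \<longlongrightarrow> ?D z (v t)) (at z)"
            using deriv[OF z, of "v t"] elim by (simp add: has_field_derivative_iff)
          moreover have "filterlim Y (at z) sequentially"
            using Y by (auto simp: filterlim_at)
          ultimately show ?case by (intro tendsto_mult tendsto_const) (rule filterlim_compose)
        qed
        show "AE t in M. norm (?q n t) \<le> norm a * K * norm (g t)" for n
          using v01
        proof eventually_elim
          case (elim t)
          have "norm (((1 - Y n * of_real (v t)) powr a - (1 - z * of_real (v t)) powr a) / (Y n - z)) \<le> norm a * K"
            using bound[OF Y(3)[of n], of "v t"] elim Y(2)[of n] by (simp add: norm_divide divide_simps)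
          from mult_left_mono[OF this, of "norm (g t)"] show ?case by (simp add: norm_mult norm_divide mult_ac)
        qed
      qed measurable
      moreover have "(\<integral>t. ?q n t \<partial>M) = (?I (Y n) - ?I z) / (Y n - z)" for n
      proof -
        have "Y n \<in> slit_plane" using Y(3) rK(2) by blast
        note i = integrable_slit_kernel[OF g v v01 this, of a] integrable_slit_kernel[OF g v v01 z, of a]
        show ?thesis
          by (subst Bochner_Integration.integral_diff[OF i, symmetric], subst integral_divide_zero[symmetric])
             (simp add: algebra_simps diff_divide_distrib)
      qed
      ultimately have "(\<lambda>n. (?I (X (n + N)) - ?I z) / (X (n + N) - z)) \<longlonglongrightarrow> (\<integral>t. g t * ?D z (v t) \<partial>M)"
        unfolding Y_def by (simp only:)
      thus "(\<lambda>n. (?I (X n) - ?I z) / (X n - z)) \<longlonglongrightarrow> (\<integral>t. g t * ?D z (v t) \<partial>M)"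
        by (rule LIMSEQ_offset)
    qed
  qed
  thus ?thesis unfolding holomorphic_on_open[OF open_slit_plane] by blast
qed

text \<open>Since |z v| is at most |z| < 1, the binomial series of the kernel is dominated uniformly
  in t, so only the moments of v weighted by g remain.\<close>

lemma slit_kernel_integral_sums:
  fixes g :: "'a \<Rightarrow> complex" and v :: "'a \<Rightarrow> real"
  assumes g: "integrable M g" and v [measurable]: "v \<in> borel_measurable M"
    and v01: "AE t in M. 0 \<le> v t \<and> v t \<le> 1" and z: "norm z < 1"
  shows "(\<integral>t. g t * (1 - z * of_real (v t)) powr (- a) \<partial>M) =
    (\<Sum>k. pochhammer a k / fact k * (\<integral>t. g t * of_real (v t) ^ k \<partial>M) * z ^ k)"
proof -
  have [measurable]: "g \<in> borel_measurable M" using g by simp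
  define f where "f = (\<lambda>k t. pochhammer a k / fact k * z ^ k * (g t * of_real (v t) ^ k))"
  have gv: "integrable M (\<lambda>t. g t * of_real (v t) ^ k)" for k
  proof (rule Bochner_Integration.integrable_bound[OF g])
    show "AE t in M. norm (g t * of_real (v t) ^ k) \<le> norm (g t)"
      using v01 by eventually_elim (auto simp: norm_mult norm_power power_le_one intro!: mult_left_le)
  qed measurable
  have f: "has_bochner_integral M (f k) (pochhammer a k / fact k * z ^ k * (\<integral>t. g t * of_real (v t) ^ k \<partial>M))" for k
    unfolding f_def using gv[of k] by (intro has_bochner_integral_mult_right has_bochner_integral_integrable)
  note b = binomial_series_pochhammer(2)[OF z, of a]
  have "summable (\<lambda>k. \<integral>t. norm (f k t) \<partial>M)"
  proof (rule summable_comparison_test)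
    show "summable (\<lambda>k. norm (pochhammer a k / fact k * z ^ k) * (\<integral>t. norm (g t) \<partial>M))"
      by (rule summable_mult2[OF b])
    have "(\<integral>t. norm (f k t) \<partial>M) \<le> norm (pochhammer a k / fact k * z ^ k) * (\<integral>t. norm (g t) \<partial>M)" for k
    proof -
      have "(\<integral>t. norm (f k t) \<partial>M) \<le> (\<integral>t. norm (pochhammer a k / fact k * z ^ k) * norm (g t) \<partial>M)"
      proof (rule integral_mono_AE)
        show "integrable M (\<lambda>t. norm (f k t))" using f[of k] by (auto simp: has_bochner_integral_iff)
        show "AE t in M. norm (f k t) \<le> norm (pochhammer a k / fact k * z ^ k) * norm (g t)"
          using v01
        proof eventually_elim
          case (elim t)
          have "norm (g t * of_real (v t) ^ k) \<le> norm (g t)"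
            using elim by (auto simp: norm_mult norm_power power_le_one intro!: mult_left_le)
          thus ?case unfolding f_def norm_mult[of "pochhammer a k / fact k * z ^ k"] by (intro mult_left_mono) auto
        qed
      qed (use g in auto)
      thus ?thesis by simp
    qed
    thus "\<exists>N. \<forall>k\<ge>N. norm (\<integral>t. norm (f k t) \<partial>M) \<le> norm (pochhammer a k / fact k * z ^ k) * (\<integral>t. norm (g t) \<partial>M)"
      by (auto simp: integral_nonneg_AE)
  qed
  moreover have "AE t in M. summable (\<lambda>k. norm (f k t)) \<and> (\<lambda>k. f k t) sums (g t * (1 - z * of_real (v t)) powr (- a))"
    using v01
  proof eventually_elim
    case (elim t)
    have f_eq: "f k t = g t * (pochhammer a k / fact k * (z * of_real (v t)) ^ k)" for k
      by (simp add: f_def power_mult_distrib)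
    have "norm (z * complex_of_real (v t)) \<le> norm z * 1" using elim
      unfolding norm_mult by (intro mult_left_mono) auto
    hence "norm (z * complex_of_real (v t)) < 1" using z by simp
    note b = binomial_series_pochhammer[OF this, of a]
    show ?case unfolding f_eq norm_mult[of "g t"]
      using sums_mult[OF b(1)] summable_mult[OF b(2)] by blast
  qed
  ultimately have "has_bochner_integral M (\<lambda>t. g t * (1 - z * of_real (v t)) powr (- a))
     (\<Sum>k. pochhammer a k / fact k * z ^ k * (\<integral>t. g t * of_real (v t) ^ k \<partial>M))"
    by (rule has_bochner_integral_suminf(1)[OF f]) measurable
  thus ?thesis by (simp add: has_bochner_integral_iff mult_ac)
qed

subsection \<open>Analytic continuation of the hypergeometric series\<close>

context unit_uniform
begin

text \<open>The k-th moment of G in 1 - u is \<open>hypergeometric_beta\<close> with q = A + k,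
  upper parameters a and c - b. Its Gamma arguments become A + k, B + k, s + k and C + k. The
  binomial factor (s)_k absorbs the shift in s, and what remains is a constant times the k-th
  coefficient of F(A, B; C; z).\<close>

lemma hypergeometric_kernel_integral:
  fixes a b c s :: complex
  defines "A \<equiv> a - c + s" and "B \<equiv> b - c + s" and "C \<equiv> a + b - c + s"
  defines "G \<equiv> (\<lambda>t. of_real (u t) powr (c - 1) * of_real (1 - u t) powr (A - 1) *
                    (\<Sum>n. hyp_coeff a (c - b) c n * of_real (u t) ^ n))"
  assumes c: "Re c > 0" and A: "Re A > 0" and B: "Re B > 0" and C: "C \<notin> \<int>\<^sub>\<le>\<^sub>0"
  shows "(\<lambda>z. \<integral>t. G t * (1 - z * of_real (1 - u t)) powr (- s) \<partial>M) holomorphic_on slit_plane"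
    and "z \<in> slit_plane \<Longrightarrow> integrable M (\<lambda>t. G t * (1 - z * of_real (1 - u t)) powr (- s))"
    and "norm z < 1 \<Longrightarrow> (\<integral>t. G t * (1 - z * of_real (1 - u t)) powr (- s) \<partial>M) =
           Gamma c * Gamma A * Gamma B * rGamma s * rGamma C * (\<Sum>k. hyp_coeff A B C k * z ^ k)"
proof -
  have G_moment: "has_bochner_integral M (\<lambda>t. G t * of_real (1 - u t) ^ k)
      (Gamma c * Gamma (A + of_nat k) * Gamma (B + of_nat k) * rGamma (s + of_nat k) * rGamma (C + of_nat k))" for k
  proof -
    have "has_bochner_integral M (\<lambda>t. of_real (u t) powr (c - 1) * of_real (1 - u t) powr (A + of_nat k - 1) *
              (\<Sum>n. hyp_coeff a (c - b) c n * of_real (u t) ^ n))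
      (Gamma c * Gamma (A + of_nat k) * Gamma (c + (A + of_nat k) - a - (c - b)) *
       rGamma (c + (A + of_nat k) - a) * rGamma (c + (A + of_nat k) - (c - b)))" (is "has_bochner_integral M ?f ?x")
      by (rule hypergeometric_beta) (use c A B in \<open>auto simp: A_def B_def\<close>)
    also have "?x = Gamma c * Gamma (A + of_nat k) * Gamma (B + of_nat k) * rGamma (s + of_nat k) * rGamma (C + of_nat k)"
      by (simp add: A_def B_def C_def algebra_simps)
    finally show ?thesis
    proof (rule has_bochner_integral_cong_AE[THEN iffD1, rotated -1])
      show "AE t in M. ?f t = G t * of_real (1 - u t) ^ k"
        using u_bounds
      proof eventually_elim
        case (elim t)
        have "complex_of_real (1 - u t) powr (A + of_nat k - 1) = of_real (1 - u t) powr (A - 1) * of_real (1 - u t) ^ k"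
          using of_real_powr_plus_of_nat[of "1 - u t" "A - 1" k] elim by (simp add: algebra_simps)
        thus ?case by (simp add: G_def)
      qed
    qed (unfold G_def, measurable)
  qed
  have G: "integrable M G"
    using G_moment[of 0] by (simp add: has_bochner_integral_iff)
  have v: "(\<lambda>t. 1 - u t) \<in> borel_measurable M" by measurable
  have v01: "AE t in M. 0 \<le> 1 - u t \<and> 1 - u t \<le> 1" using u_bounds by eventually_elim auto
  show "(\<lambda>z. \<integral>t. G t * (1 - z * of_real (1 - u t)) powr (- s) \<partial>M) holomorphic_on slit_plane"
    by (rule holomorphic_slit_kernel_integral[OF G v v01])
  show "integrable M (\<lambda>t. G t * (1 - z * of_real (1 - u t)) powr (- s))" if "z \<in> slit_plane"
    by (rule integrable_slit_kernel[OF G v v01 that])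
  assume z: "norm z < 1"
  have "(\<integral>t. G t * (1 - z * of_real (1 - u t)) powr (- s) \<partial>M) =
    (\<Sum>k. pochhammer s k / fact k * (\<integral>t. G t * of_real (1 - u t) ^ k \<partial>M) * z ^ k)"
    by (rule slit_kernel_integral_sums[OF G v v01 z])
  also have "\<dots> = (\<Sum>k. Gamma c * Gamma A * Gamma B * rGamma s * rGamma C * (hyp_coeff A B C k * z ^ k))"
  proof (intro suminf_cong)
    fix k
    have "Gamma (A + of_nat k) = Gamma A * pochhammer A k" "Gamma (B + of_nat k) = Gamma B * pochhammer B k"
      using Re_pos_notin_nonpos_Ints[OF A] Re_pos_notin_nonpos_Ints[OF B]
      by (auto simp: pochhammer_Gamma Gamma_eq_zero_iff)
    \<comment> \<open>In terms of \<open>rGamma\<close> the shift identity holds for every complex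
      s, including nonpositive integers.\<close>
    moreover have "rGamma C = pochhammer C k * rGamma (C + of_nat k)" "rGamma s = pochhammer s k * rGamma (s + of_nat k)"
      by (rule pochhammer_rGamma)+
    moreover have "(\<integral>t. G t * of_real (1 - u t) ^ k \<partial>M) =
      Gamma c * Gamma (A + of_nat k) * Gamma (B + of_nat k) * rGamma (s + of_nat k) * rGamma (C + of_nat k)"
      using G_moment[of k] by (simp add: has_bochner_integral_iff)
    ultimately show "pochhammer s k / fact k * (\<integral>t. G t * of_real (1 - u t) ^ k \<partial>M) * z ^ k =
       Gamma c * Gamma A * Gamma B * rGamma s * rGamma C * (hyp_coeff A B C k * z ^ k)"
      using pochhammer_neq_0[OF C, of k] by (simp add: hyp_coeff_def)
  qed
  also have "\<dots> = Gamma c * Gamma A * Gamma B * rGamma s * rGamma C * (\<Sum>k. hyp_coeff A B C k * z ^ k)"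
    by (rule suminf_mult[OF summable_norm_cancel[OF summable_hyp_coeff_power[OF C z]]])
  finally show "(\<integral>t. G t * (1 - z * of_real (1 - u t)) powr (- s) \<partial>M) =
           Gamma c * Gamma A * Gamma B * rGamma s * rGamma C * (\<Sum>k. hyp_coeff A B C k * z ^ k)" .
qed

end

text \<open>Under this measure \<open>t / (1 + t)\<close> is uniformly distributed on \<open>(0, 1)\<close>.\<close>

definition half_line :: "real measure" where
  "half_line = density lborel (\<lambda>t. ennreal (indicator {0<..} t / (1 + t)\<^sup>2))"

text \<open>The antiderivative is (t / (1 + t))^p / p, running from 0 at the origin to 1 / p at
  infinity.\<close>

lemma half_line_moment:
  assumes p: "Re p > 0"
  shows "has_bochner_integral half_line (\<lambda>t. of_real (t / (1 + t)) powr (p - 1)) (1 / p)"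
proof -
  let ?f = "\<lambda>t. of_real (t / (1 + t)) powr (p - 1) / of_real ((1 + t)\<^sup>2) :: complex"
  define r where "r = Re p"
  have r: "r > 0" using p by (simp add: r_def)
  \<comment> \<open>First the real exponent: the integrand is nonnegative, so the fundamental
    theorem itself yields integrability. It then dominates the complex integrand.\<close>
  have "set_integrable lborel (einterval 0 \<infinity>) (\<lambda>t. (t / (1 + t)) powr (r - 1) / (1 + t)\<^sup>2)"
  proof (rule interval_integral_FTC_nonneg(1))
    fix x :: real assume "0 < ereal x"
    hence x: "x > 0" by (simp add: zero_ereal_def)
    show "((\<lambda>t. (t / (1 + t)) powr r / r) has_real_derivative (x / (1 + x)) powr (r - 1) / (1 + x)\<^sup>2) (at x)"
    proof -
      have "((\<lambda>t. t / (1 + t)) has_real_derivative 1 / (1 + x)\<^sup>2) (at x)"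
        using x by (auto intro!: derivative_eq_intros simp: power2_eq_square)
      from DERIV_cdivide[OF DERIV_fun_powr[OF this, of r], of r] show ?thesis using x r by simp
    qed
    show "isCont (\<lambda>t. (t / (1 + t)) powr (r - 1) / (1 + t)\<^sup>2) x"
      using x by (auto intro!: continuous_intros)
  next
    show "(((\<lambda>t. (t / (1 + t)) powr r / r) \<circ> real_of_ereal) \<longlongrightarrow> 0) (at_right 0)"
      unfolding zero_ereal_def ereal_tendsto_simps using r by real_asymp
    show "(((\<lambda>t. (t / (1 + t)) powr r / r) \<circ> real_of_ereal) \<longlongrightarrow> 1 / r) (at_left \<infinity>)"
      unfolding ereal_tendsto_simps using r by (real_asymp simp: divide_inverse)
  qed auto
  moreover have ei: "einterval 0 \<infinity> = {0<..}" by (auto simp: einterval_def zero_ereal_def)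
  ultimately have int_r: "set_integrable lborel {0<..} (\<lambda>t. (t / (1 + t)) powr (r - 1) / (1 + t)\<^sup>2)" by simp
  have f_int: "set_integrable lborel {0<..} ?f"
  proof (rule set_integrable_bound[OF int_r])
    show "AE t in lborel. t \<in> {0<..} \<longrightarrow> norm (?f t) \<le> norm ((t / (1 + t)) powr (r - 1) / (1 + t)\<^sup>2)"
      by (intro AE_I2) (auto simp: norm_divide norm_powr_real_powr r_def simp del: of_real_add of_real_divide of_real_power)
    show "set_borel_measurable lborel {0<..} ?f"
      unfolding set_borel_measurable_def by measurable
  qed
  have p0: "p \<noteq> 0" using p by auto
  have "(LBINT t=0..\<infinity>. ?f t) = 1 / p - 0"
  proof (rule interval_integral_FTC_integrable)
    fix x :: real assume "0 < ereal x"
    hence x: "x > 0" by (simp add: zero_ereal_def)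
    have nz: "1 + complex_of_real x \<noteq> 0" using x by (auto simp: complex_eq_iff)
    have nn: "complex_of_real x / (1 + complex_of_real x) \<notin> \<real>\<^sub>\<le>\<^sub>0"
    proof -
      have "complex_of_real x / (1 + complex_of_real x) = of_real (x / (1 + x))" by simp
      also have "\<dots> \<notin> \<real>\<^sub>\<le>\<^sub>0" using x unfolding complex_nonpos_Reals_iff by (simp add: not_le)
      finally show ?thesis .
    qed
    \<comment> \<open>The derivative is taken in the complex variable and then restricted to the
      real axis.\<close>
    have "((\<lambda>z. (z / (1 + z)) powr p / p) has_field_derivative
        (of_real x / (1 + of_real x)) powr (p - 1) / (1 + of_real x)\<^sup>2) (at (complex_of_real x))"
    proof -
      have "((\<lambda>z. z / (1 + z)) has_field_derivative 1 / (1 + of_real x)\<^sup>2) (at (complex_of_real x))"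
        using nz by (auto intro!: derivative_eq_intros simp: power2_eq_square)
      from DERIV_cdivide[OF DERIV_chain2[OF has_field_derivative_powr[OF nn, of p] this], of p]
      show ?thesis using p by (simp split: if_splits)
    qed
    from has_vector_derivative_real_field[OF this]
    show "((\<lambda>t. of_real (t / (1 + t)) powr p / p) has_vector_derivative ?f x) (at x)" by simp
    show "isCont ?f x"
      using x nn nz unfolding of_real_divide of_real_add of_real_1 of_real_power
      by (intro continuous_intros isCont_powr_complex) (auto simp del: complex_nonpos_Reals_iff)
  next
    have "((\<lambda>t::real. t / (1 + t)) \<longlongrightarrow> 0) (at_right 0)" by real_asymp
    hence "((\<lambda>t. complex_of_real (t / (1 + t))) \<longlongrightarrow> of_real 0) (at_right 0)" by (rule tendsto_of_real)
    hence "((\<lambda>t. of_real (t / (1 + t)) powr p) \<longlongrightarrow> 0) (at_right 0)"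
      using p by (intro tendsto_powr_complex_0[where b = p]) auto
    from tendsto_divide[OF this tendsto_const[of p]]
    show "(((\<lambda>t. of_real (t / (1 + t)) powr p / p) \<circ> real_of_ereal) \<longlongrightarrow> 0) (at_right 0)"
      unfolding zero_ereal_def ereal_tendsto_simps using p0 by auto
    have "((\<lambda>t::real. t / (1 + t)) \<longlongrightarrow> 1) at_top" by real_asymp
    hence "((\<lambda>t. complex_of_real (t / (1 + t))) \<longlongrightarrow> of_real 1) at_top" by (rule tendsto_of_real)
    hence "((\<lambda>t. of_real (t / (1 + t)) powr p) \<longlongrightarrow> of_real 1 powr p) at_top"
      by (intro tendsto_powr_complex) auto
    from tendsto_divide[OF this tendsto_const[of p]]
    show "(((\<lambda>t. of_real (t / (1 + t)) powr p / p) \<circ> real_of_ereal) \<longlongrightarrow> 1 / p) (at_left \<infinity>)"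
      unfolding ereal_tendsto_simps using p0 by auto
  qed (use f_int ei in auto)
  hence f_val: "(LBINT t:{0<..}. ?f t) = 1 / p"
    by (simp add: interval_lebesgue_integral_def ei)
  have eq: "indicator {0<..} t *\<^sub>R ?f t = (indicator {0<..} t / (1 + t)\<^sup>2) *\<^sub>R of_real (t / (1 + t)) powr (p - 1)" for t :: real
    by (simp add: indicator_def scaleR_conv_of_real)
  show ?thesis unfolding half_line_def
  proof (rule has_bochner_integral_density)
    show "has_bochner_integral lborel (\<lambda>t. (indicator {0<..} t / (1 + t)\<^sup>2) *\<^sub>R of_real (t / (1 + t)) powr (p - 1)) (1 / p)"
      using f_int f_val unfolding set_integrable_def set_lebesgue_integral_def eq has_bochner_integral_iff by simp
  qed (auto simp: indicator_def)
qed

interpretation half_line: unit_uniform half_line "\<lambda>t. t / (1 + t)"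
proof
  show "(\<lambda>t. t / (1 + t)) \<in> borel_measurable half_line" unfolding half_line_def by measurable
  show "AE t in half_line. 0 < t / (1 + t) \<and> t / (1 + t) < 1"
    unfolding half_line_def by (subst AE_density) (auto split: split_indicator)
qed (rule half_line_moment)

text \<open>The property under the choice operator in \<open>hyp2F1\<close>, made a predicate of the
  parameters so that existence can be proved by induction on them.\<close>

definition hyp_continuation :: "complex \<Rightarrow> complex \<Rightarrow> complex \<Rightarrow> (complex \<Rightarrow> complex) \<Rightarrow> bool" where
  "hyp_continuation a b c f \<longleftrightarrow> f holomorphic_on slit_plane \<and>
     (\<forall>z\<in>ball 0 1. f z = (\<Sum>n. hyp_coeff a b c n * z ^ n))"

lemma hyp_continuation_commute: "hyp_continuation a b c = hyp_continuation b a c"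
  by (simp add: hyp_continuation_def fun_eq_iff hyp_coeff_commute[of a b])

text \<open>
  The kernel integral represents \<open>F(A, B; C; z)\<close> with \<open>a = C - B\<close>, \<open>b = C - A\<close>; the parameter
  \<open>c\<close> is free and is taken so large that the constant in front does not vanish.
\<close>

lemma hyp_continuation_exists_pos:
  assumes A: "Re A > 0" and B: "Re B > 0" and C: "C \<notin> \<int>\<^sub>\<le>\<^sub>0"
  shows "\<exists>f. hyp_continuation A B C f"
proof -
  \<comment> \<open>The maximum ensures both Re c >= 1 and Re s >= 1, so neither
    \<open>Gamma c\<close> nor \<open>rGamma s\<close> vanishes.\<close>
  define c where "c = complex_of_real (max 1 (1 + Re (C - A - B)))"
  define s where "s = A + B - C + c"
  have c: "Re c > 0" and s: "Re s > 0" by (auto simp: c_def s_def)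
  have eqs: "(C - B) - c + s = A" "(C - A) - c + s = B" "(C - B) + (C - A) - c + s = C"
    by (simp_all add: s_def)
  note K = half_line.hypergeometric_kernel_integral[of c "C - B" s "C - A", unfolded eqs, OF c A B C]
  define k where "k = Gamma c * Gamma A * Gamma B * rGamma s * rGamma C"
  have "k \<noteq> 0" using Re_pos_notin_nonpos_Ints A B c s C
    by (auto simp: k_def Gamma_eq_zero_iff rGamma_eq_zero_iff)
  define I where "I = (\<lambda>z. \<integral>t. of_real (t / (1 + t)) powr (c - 1) * of_real (1 - t / (1 + t)) powr (A - 1) *
              (\<Sum>n. hyp_coeff (C - B) (c - (C - A)) c n * of_real (t / (1 + t)) ^ n) *
              (1 - z * of_real (1 - t / (1 + t))) powr (- s) \<partial>half_line)"
  have "hyp_continuation A B C (\<lambda>z. I z / k)"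
    unfolding hyp_continuation_def
  proof safe
    show "(\<lambda>z. I z / k) holomorphic_on slit_plane"
      using K(1) \<open>k \<noteq> 0\<close> unfolding I_def by (intro holomorphic_intros) auto
    fix z :: complex assume "z \<in> ball 0 1"
    hence "I z = k * (\<Sum>n. hyp_coeff A B C n * z ^ n)"
      using K(3)[of z] by (simp add: I_def k_def)
    thus "I z / k = (\<Sum>n. hyp_coeff A B C n * z ^ n)" using \<open>k \<noteq> 0\<close> by simp
  qed
  thus ?thesis by blast
qed

text \<open>
  This contiguous relation is chosen because its only denominator is \<open>c\<close>, so that it reduces
  arbitrary \<open>a\<close>, \<open>b\<close> to positive real parts without exceptional parameters.
\<close>

lemma hyp_coeff_contiguous:
  assumes c: "c \<notin> \<int>\<^sub>\<le>\<^sub>0"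
  shows "hyp_coeff a (b + 1) c (Suc n) - hyp_coeff a b c (Suc n) = a / c * hyp_coeff (a + 1) (b + 1) (c + 1) n"
proof -
  have "c + 1 \<notin> \<int>\<^sub>\<le>\<^sub>0" "c \<noteq> 0" using c plus_one_in_nonpos_Ints_imp by auto
  hence nz: "pochhammer (c + 1) n \<noteq> 0" "c \<noteq> 0" by (auto dest: pochhammer_neq_0)
  have "hyp_coeff a (b + 1) c (Suc n) = (a * pochhammer (a + 1) n) * (pochhammer (b + 1) n * (b + 1 + of_nat n)) /
     (c * pochhammer (c + 1) n * (of_nat (Suc n) * fact n))"
    by (simp only: hyp_coeff_def pochhammer_rec[of a] pochhammer_rec[of c] pochhammer_Suc[of "b + 1"] fact_Suc)
  moreover have "hyp_coeff a b c (Suc n) = (a * pochhammer (a + 1) n) * (b * pochhammer (b + 1) n) /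
     (c * pochhammer (c + 1) n * (of_nat (Suc n) * fact n))"
    by (simp only: hyp_coeff_def pochhammer_rec[of a] pochhammer_rec[of c] pochhammer_rec[of b] fact_Suc)
  ultimately have "hyp_coeff a (b + 1) c (Suc n) - hyp_coeff a b c (Suc n) =
     (a * pochhammer (a + 1) n * pochhammer (b + 1) n * of_nat (Suc n)) / (c * pochhammer (c + 1) n * (of_nat (Suc n) * fact n))"
    by (simp add: diff_divide_distrib[symmetric] algebra_simps)
  also have "\<dots> = a / c * hyp_coeff (a + 1) (b + 1) (c + 1) n"
    using nz by (simp add: hyp_coeff_def del: of_nat_Suc)
  finally show ?thesis .
qed

text \<open>Both series start with 1, so only indices n + 1 need comparison, and there
  \<open>hyp_coeff_contiguous\<close> applies coefficientwise.\<close>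

lemma hyp_continuation_contiguous:
  assumes c: "c \<notin> \<int>\<^sub>\<le>\<^sub>0"
    and f: "hyp_continuation a (b + 1) c f" and g: "hyp_continuation (a + 1) (b + 1) (c + 1) g"
  shows "hyp_continuation a b c (\<lambda>z. f z - a / c * z * g z)"
  unfolding hyp_continuation_def
proof safe
  show "(\<lambda>z. f z - a / c * z * g z) holomorphic_on slit_plane"
    using f g by (auto simp: hyp_continuation_def intro!: holomorphic_intros)
  fix z :: complex assume z: "z \<in> ball 0 1"
  hence z': "norm z < 1" by simp
  have c1: "c + 1 \<notin> \<int>\<^sub>\<le>\<^sub>0" using c plus_one_in_nonpos_Ints_imp by blast
  note s = summable_norm_cancel[OF summable_hyp_coeff_power[OF c z']]
  note s1 = summable_norm_cancel[OF summable_hyp_coeff_power[OF c1 z']]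
  have "(\<Sum>n. hyp_coeff a b c n * z ^ n) = 1 + (\<Sum>n. hyp_coeff a b c (Suc n) * z ^ Suc n)"
    by (subst suminf_split_head[OF s]) simp
  also have "(\<Sum>n. hyp_coeff a b c (Suc n) * z ^ Suc n) =
    (\<Sum>n. hyp_coeff a (b + 1) c (Suc n) * z ^ Suc n - a / c * z * (hyp_coeff (a + 1) (b + 1) (c + 1) n * z ^ n))"
  proof (intro suminf_cong)
    fix n
    have "hyp_coeff a b c (Suc n) = hyp_coeff a (b + 1) c (Suc n) - a / c * hyp_coeff (a + 1) (b + 1) (c + 1) n"
      by (subst hyp_coeff_contiguous[OF c, of a b, symmetric]) simp
    thus "hyp_coeff a b c (Suc n) * z ^ Suc n = hyp_coeff a (b + 1) c (Suc n) * z ^ Suc n -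
        a / c * z * (hyp_coeff (a + 1) (b + 1) (c + 1) n * z ^ n)"
      by (simp only: left_diff_distrib right_diff_distrib power_Suc mult_ac)
  qed
  also have "\<dots> = (\<Sum>n. hyp_coeff a (b + 1) c (Suc n) * z ^ Suc n) - a / c * z * (\<Sum>n. hyp_coeff (a + 1) (b + 1) (c + 1) n * z ^ n)"
  proof -
    have "summable (\<lambda>n. hyp_coeff a (b + 1) c (Suc n) * z ^ Suc n)"
      using s[of a "b + 1"] summable_Suc_iff[of "\<lambda>n. hyp_coeff a (b + 1) c n * z ^ n"] by blast
    from suminf_diff[OF this summable_mult[OF s1], of "a / c * z" "a + 1" "b + 1"]
    show ?thesis unfolding suminf_mult[OF s1] by (rule sym)
  qed
  also have "1 + \<dots> = (\<Sum>n. hyp_coeff a (b + 1) c n * z ^ n) - a / c * z * (\<Sum>n. hyp_coeff (a + 1) (b + 1) (c + 1) n * z ^ n)"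
    using suminf_split_head[OF s[of a "b + 1"]] by simp
  finally show "f z - a / c * z * g z = (\<Sum>n. hyp_coeff a b c n * z ^ n)"
    using f g z by (simp add: hyp_continuation_def)
qed

lemma hyp_continuation_exists:
  assumes "c \<notin> \<int>\<^sub>\<le>\<^sub>0"
  shows "\<exists>f. hyp_continuation a b c f"
proof -
  have c1: "c + 1 \<notin> \<int>\<^sub>\<le>\<^sub>0" if "c \<notin> \<int>\<^sub>\<le>\<^sub>0" for c :: complex
    using that plus_one_in_nonpos_Ints_imp by blast
  \<comment> \<open>Each contiguous step raises Re b by 1. The second function needed also has a and
    c raised, which preserves the conditions on them.\<close>
  have *: "\<exists>f. hyp_continuation a b c f" if "Re b > - real n" "Re a > 0" "c \<notin> \<int>\<^sub>\<le>\<^sub>0" for n a b c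
    using that
  proof (induction n arbitrary: a b c)
    case 0 thus ?case by (intro hyp_continuation_exists_pos) auto
  next
    case (Suc n)
    obtain f g where "hyp_continuation a (b + 1) c f" "hyp_continuation (a + 1) (b + 1) (c + 1) g"
      using Suc.IH[of "b + 1" a c] Suc.IH[of "b + 1" "a + 1" "c + 1"] Suc.prems c1[of c] by auto
    from hyp_continuation_contiguous[OF Suc.prems(3) this] show ?case by blast
  qed
  \<comment> \<open>The same induction in a, with a and b exchanged by symmetry; the base case is
    the previous claim with b arbitrary.\<close>
  have **: "\<exists>f. hyp_continuation a b c f" if "Re a > - real n" "c \<notin> \<int>\<^sub>\<le>\<^sub>0" for n a b c
    using that
  proof (induction n arbitrary: a b c)
    case 0
    obtain m where "- Re b < real m" using reals_Archimedean2 by blast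
    with 0 *[of m b a c] show ?case by auto
  next
    case (Suc n)
    obtain f g where "hyp_continuation b (a + 1) c f" "hyp_continuation (b + 1) (a + 1) (c + 1) g"
      using Suc.IH[of "a + 1" c b] Suc.IH[of "a + 1" "c + 1" "b + 1"] Suc.prems c1[of c]
      by (auto simp: hyp_continuation_commute[of "a + 1"])
    from hyp_continuation_contiguous[OF Suc.prems(2) this] show ?case
      unfolding hyp_continuation_commute[of a] by blast
  qed
  obtain m where "- Re a < real m" using reals_Archimedean2 by blast
  with **[of m a c b] assms show ?thesis by auto
qed

text \<open>Existence of a continuation turns the choice in \<open>hyp2F1\<close> into usable
  properties.\<close>

lemma
  assumes "c \<notin> \<int>\<^sub>\<le>\<^sub>0"
  shows holomorphic_hyp2F1: "hyp2F1 a b c holomorphic_on slit_plane"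
    and hyp2F1_eq_suminf: "norm z < 1 \<Longrightarrow> hyp2F1 a b c z = (\<Sum>n. hyp_coeff a b c n * z ^ n)"
proof -
  have "hyp2F1 a b c = (SOME f. hyp_continuation a b c f)"
    by (simp add: hyp2F1_def hyp_continuation_def slit_plane_def hyp_coeff_def)
  hence "hyp_continuation a b c (hyp2F1 a b c)"
    using someI_ex[OF hyp_continuation_exists[OF assms]] by simp
  thus "hyp2F1 a b c holomorphic_on slit_plane"
       "norm z < 1 \<Longrightarrow> hyp2F1 a b c z = (\<Sum>n. hyp_coeff a b c n * z ^ n)"
    by (auto simp: hyp_continuation_def)
qed

subsection \<open>Pfaff and Euler transformations\<close>

lemma binomial_series_pochhammer_real:
  assumes "\<bar>r :: real\<bar> < 1"
  shows "(\<lambda>n. pochhammer s n / fact n * r ^ n) sums (1 - r) powr (- s)"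
proof -
  have "(\<lambda>n. (- s gchoose n) * (- r) ^ n) sums (1 + (- r)) powr (- s)"
    by (rule gen_binomial_real) (use assms in simp)
  moreover have "(- s gchoose n) * (- r) ^ n = pochhammer s n / fact n * r ^ n" for n
    by (simp add: gbinomial_pochhammer power_minus[of r])
  ultimately show ?thesis by simp
qed

lemma norm_pochhammer_le:
  assumes "norm (x :: complex) \<le> y"
  shows "norm (pochhammer x n) \<le> pochhammer y n"
  unfolding pochhammer_prod prod_norm[symmetric]
proof (intro prod_mono conjI norm_ge_zero)
  fix i :: nat
  show "norm (x + of_nat i) \<le> y + of_nat i"
    using norm_triangle_ineq[of x "of_nat i"] assms by simp
qed

lemma pochhammer_minus_of_nat:
  assumes "n \<le> N"
  shows "pochhammer (- of_nat N :: complex) n = (-1) ^ n * fact N / fact (N - n)"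
proof -
  have "pochhammer 1 (N - n) * pochhammer (1 + of_nat (N - n)) n = (pochhammer 1 N :: complex)"
    using assms pochhammer_product'[of "1 :: complex" "N - n" n] by simp
  hence "pochhammer (of_nat N - of_nat n + 1) n = (fact N / fact (N - n) :: complex)"
    using assms by (simp add: pochhammer_fact[symmetric] of_nat_diff field_simps)
  thus ?thesis by (simp add: pochhammer_minus)
qed

text \<open>Since (a)_n (a + n)_(N - n) = (a)_N, the parameter a factors out. The remaining finite
  sum, with upper parameter -N, is a Chu-Vandermonde sum equal to (b)_N / (c)_N.\<close>

lemma Pfaff_coeff:
  assumes c: "c \<notin> \<int>\<^sub>\<le>\<^sub>0"
  shows "(\<Sum>n\<le>N. hyp_coeff a (c - b) c n * (-1) ^ n * (pochhammer (a + of_nat n) (N - n) / fact (N - n))) = hyp_coeff a b c N"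
proof -
  have "hyp_coeff a (c - b) c n * (-1) ^ n * (pochhammer (a + of_nat n) (N - n) / fact (N - n)) =
        pochhammer a N / fact N * (pochhammer (c - b) n * pochhammer (- of_nat N) n / (of_nat (fact n) * pochhammer c n))" if "n \<le> N" for n
  proof -
    have "pochhammer a N = pochhammer a n * pochhammer (a + of_nat n) (N - n)"
      by (rule pochhammer_product[OF that])
    thus ?thesis by (simp add: hyp_coeff_def pochhammer_minus_of_nat[OF that] mult_ac)
  qed
  hence "(\<Sum>n\<le>N. hyp_coeff a (c - b) c n * (-1) ^ n * (pochhammer (a + of_nat n) (N - n) / fact (N - n))) =
     pochhammer a N / fact N * (\<Sum>n=0..N. pochhammer (c - b) n * pochhammer (- of_nat N) n / (of_nat (fact n) * pochhammer c n))"
    by (simp add: sum_distrib_left atMost_atLeast0)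
  also have "(\<Sum>n=0..N. pochhammer (c - b) n * pochhammer (- of_nat N) n / (of_nat (fact n) * pochhammer c n)) =
      pochhammer (c - (c - b)) N / pochhammer c N"
  proof (rule Vandermonde_pochhammer)
    show "\<forall>i\<in>{0..<N}. c \<noteq> - of_nat i" using plus_of_nat_neq_0[OF c] by (auto simp: eq_neg_iff_add_eq_0)
  qed
  finally show ?thesis by (simp add: hyp_coeff_def)
qed

text \<open>Expanding (1 - z)^(-a - n) in every term gives an absolutely summable double series.
  Summing over m for fixed n yields the right-hand side; summing along diagonals n + m = N yields
  the left-hand side by \<open>Pfaff_coeff\<close>. For |z| < 1/4 the majorant involves powers of r
  / (1 - r) < 1.\<close>

lemma Pfaff_near_0:
  assumes c: "c \<notin> \<int>\<^sub>\<le>\<^sub>0" and z: "norm z < 1 / 4"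
  shows "(\<Sum>n. hyp_coeff a b c n * z ^ n) = (1 - z) powr (- a) * (\<Sum>n. hyp_coeff a (c - b) c n * (z / (z - 1)) ^ n)"
proof -
  define h where "h = hyp_coeff a (c - b) c"
  define f where "f = (\<lambda>(n, m). h n * (-1) ^ n * (pochhammer (a + of_nat n) m / fact m) * z ^ (n + m))"
  define r where "r = norm z"
  have r: "0 \<le> r" "r < 1 / 4" using z by (auto simp: r_def)
  have z1: "1 - z \<noteq> 0" "norm z < 1" using z by auto
  \<comment> \<open>Then |a + n| <= y + n majorises the Pochhammer symbols, and the summand 1 makes
    y + n strictly positive.\<close>
  define y where "y = norm a + 1"
  define F where "F = (\<lambda>(n, m). norm (h n) * (pochhammer (y + real n) m / fact m) * r ^ (n + m))"
  have y: "y + real n > 0" for n using norm_ge_zero[of a] unfolding y_def by linarith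
  have F_nonneg: "F x \<ge> 0" for x
    using r y unfolding F_def by (auto split: prod.split intro!: mult_nonneg_nonneg divide_nonneg_nonneg pochhammer_nonneg)
  have F_inner: "((\<lambda>m. F (n, m)) has_sum ((1 - r) powr (- y) * (norm (h n) * (r / (1 - r)) ^ n))) UNIV" for n
  proof (rule sums_nonneg_imp_has_sum)
    have "(\<lambda>m. norm (h n) * r ^ n * (pochhammer (y + real n) m / fact m * r ^ m)) sums
            (norm (h n) * r ^ n * (1 - r) powr (- (y + real n)))"
      using r by (intro sums_mult binomial_series_pochhammer_real) auto
    also have "(1 - r) powr (- (y + real n)) = (1 - r) powr (- y) / (1 - r) ^ n"
      using r by (simp add: powr_diff powr_realpow powr_minus)
    finally show "(\<lambda>m. F (n, m)) sums ((1 - r) powr (- y) * (norm (h n) * (r / (1 - r)) ^ n))"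
      by (simp add: F_def power_add power_divide mult_ac)
  qed (rule F_nonneg)
  have F_summable: "F summable_on (UNIV \<times> UNIV)"
  proof (rule summable_on_SigmaI[OF F_inner])
    have "norm (complex_of_real (r / (1 - r))) < 1" using r unfolding norm_of_real by (simp add: field_simps)
    hence "summable (\<lambda>n. norm (h n * of_real (r / (1 - r)) ^ n))"
      unfolding h_def by (rule summable_hyp_coeff_power[OF c])
    also have "(\<lambda>n. norm (h n * complex_of_real (r / (1 - r)) ^ n)) = (\<lambda>n. norm (h n) * (r / (1 - r)) ^ n)"
      using r by (simp add: norm_mult norm_power norm_divide fun_eq_iff del: of_real_divide)
    finally have "(\<lambda>n. norm (h n) * (r / (1 - r)) ^ n) summable_on UNIV"
      using r by (intro summable_nonneg_imp_summable_on) auto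
    thus "(\<lambda>n. (1 - r) powr (- y) * (norm (h n) * (r / (1 - r)) ^ n)) summable_on UNIV"
      by (rule summable_on_cmult_right)
  qed (use F_nonneg in auto)
  have f_le: "norm (f x) \<le> F x" for x
  proof (cases x)
    case (Pair n m)
    have "norm (a + of_nat n) \<le> y + real n"
      using norm_triangle_ineq[of a "of_nat n"] by (simp add: y_def)
    hence "norm (pochhammer (a + of_nat n) m) \<le> pochhammer (y + real n) m"
      by (rule norm_pochhammer_le)
    thus ?thesis using r unfolding Pair f_def F_def
      by (auto simp: norm_mult norm_power norm_divide r_def intro!: mult_right_mono mult_left_mono divide_right_mono)
  qed
  have "f summable_on (UNIV \<times> UNIV)"
    by (rule Infinite_Sum.abs_summable_summable[OF Infinite_Sum.abs_summable_on_comparison_test'[OF F_summable f_le]])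
  then obtain T where T: "(f has_sum T) (UNIV \<times> UNIV)" by (auto simp: summable_on_def)
  have "((\<lambda>n. (1 - z) powr (- a) * (h n * (z / (z - 1)) ^ n)) has_sum T) UNIV"
  proof (rule has_sum_SigmaD[OF T])
    fix n
    have b: "(\<lambda>m. h n * (-1) ^ n * z ^ n * (pochhammer (a + of_nat n) m / fact m * z ^ m)) sums
       (h n * (-1) ^ n * z ^ n * (1 - z) powr (- (a + of_nat n)))"
      by (rule sums_mult[OF binomial_series_pochhammer(1)[OF z1(2)]])
    have b': "summable (\<lambda>m. norm (h n * (-1) ^ n * z ^ n * (pochhammer (a + of_nat n) m / fact m * z ^ m)))"
      unfolding norm_mult[of "h n * (-1) ^ n * z ^ n"] by (rule summable_mult[OF binomial_series_pochhammer(2)[OF z1(2)]])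
    have "(1 - z) powr (- (a + of_nat n)) = (1 - z) powr (- a) / (1 - z) ^ n"
      using z1 by (simp add: powr_diff powr_nat')
    moreover have "(z / (z - 1)) ^ n = (-1) ^ n * z ^ n / (1 - z) ^ n"
    proof -
      have "z / (z - 1) = (- z) / (1 - z)" by (metis minus_diff_eq minus_divide_divide minus_minus)
      thus ?thesis by (simp only: power_divide power_minus[of z])
    qed
    ultimately have eq: "h n * (-1) ^ n * z ^ n * (1 - z) powr (- (a + of_nat n)) = (1 - z) powr (- a) * (h n * (z / (z - 1)) ^ n)"
      by simp
    show "((\<lambda>m. f (n, m)) has_sum ((1 - z) powr (- a) * (h n * (z / (z - 1)) ^ n))) UNIV"
      using norm_summable_imp_has_sum[OF b' b] unfolding eq by (simp add: f_def power_add mult_ac)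
  qed
  hence 1: "(\<lambda>n. (1 - z) powr (- a) * (h n * (z / (z - 1)) ^ n)) sums T" by (rule has_sum_imp_sums)
  \<comment> \<open>Reindexing by the diagonal N = n + m and the position n on it.\<close>
  have "(f has_sum T) (UNIV \<times> UNIV) \<longleftrightarrow> ((\<lambda>(N, n). f (n, N - n)) has_sum T) (Sigma UNIV (\<lambda>N. {..N}))"
    by (rule has_sum_reindex_bij_witness[of _ "\<lambda>(N, n). (n, N - n)" "\<lambda>(n, m). (n + m, n)"]) auto
  with T have "((\<lambda>(N, n). f (n, N - n)) has_sum T) (Sigma UNIV (\<lambda>N. {..N}))" by simp
  hence "((\<lambda>N. hyp_coeff a b c N * z ^ N) has_sum T) UNIV"
  proof (rule has_sum_SigmaD)
    fix N :: nat
    have "(\<Sum>n\<le>N. f (n, N - n)) = (\<Sum>n\<le>N. hyp_coeff a (c - b) c n * (-1) ^ n * (pochhammer (a + of_nat n) (N - n) / fact (N - n))) * z ^ N"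
      unfolding sum_distrib_right by (intro sum.cong) (auto simp: f_def h_def)
    also have "\<dots> = hyp_coeff a b c N * z ^ N"
      by (simp only: Pfaff_coeff[OF c])
    finally show "((\<lambda>n. case (N, n) of (N, n) \<Rightarrow> f (n, N - n)) has_sum (hyp_coeff a b c N * z ^ N)) {..N}"
      by (intro has_sum_finiteI) auto
  qed
  hence 2: "(\<lambda>N. hyp_coeff a b c N * z ^ N) sums T" by (rule has_sum_imp_sums)
  have "norm (z / (z - 1)) < 1"
  proof -
    have "1 - norm z \<le> norm (z - 1)" by (metis norm_minus_commute norm_one norm_triangle_ineq2)
    thus ?thesis using z by (simp add: norm_divide divide_simps)
  qed
  hence "summable (\<lambda>n. h n * (z / (z - 1)) ^ n)"
    unfolding h_def by (intro summable_norm_cancel[OF summable_hyp_coeff_power[OF c]])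
  from suminf_mult[OF this, of "(1 - z) powr (- a)"] 1 2 show ?thesis
    by (simp add: sums_iff h_def)
qed

text \<open>In the coordinate 1 - z the Pfaff map is inversion, which preserves the complement of
  the nonpositive real axis.\<close>

lemma slit_plane_Pfaff:
  assumes "z \<in> slit_plane"
  shows "z \<noteq> 1" "1 - z / (z - 1) = inverse (1 - z)" "z / (z - 1) \<in> slit_plane"
proof -
  show z: "z \<noteq> 1" using assms by (auto simp: slit_plane_iff)
  thus eq: "1 - z / (z - 1) = inverse (1 - z)"
    by (simp add: divide_simps)
  show "z / (z - 1) \<in> slit_plane"
    using assms unfolding slit_plane_iff eq by (simp only: nonpos_Reals_inverse_iff not_False_eq_True)
qed

theorem Pfaff_transformation:
  assumes c: "c \<notin> \<int>\<^sub>\<le>\<^sub>0" and z: "z \<in> slit_plane"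
  shows "hyp2F1 a b c z = (1 - z) powr (- a) * hyp2F1 a (c - b) c (z / (z - 1))"
proof (rule holomorphic_on_slit_plane_eqI[of _ _ "1 / 4", OF _ _ _ _ z])
  show "hyp2F1 a b c holomorphic_on slit_plane" by (rule holomorphic_hyp2F1[OF c])
  have "(hyp2F1 a (c - b) c \<circ> (\<lambda>z. z / (z - 1))) holomorphic_on slit_plane"
    by (rule holomorphic_on_compose_gen[OF _ holomorphic_hyp2F1[OF c]])
       (auto intro!: holomorphic_intros dest: slit_plane_Pfaff)
  moreover have "(\<lambda>z. (1 - z) powr (- a)) holomorphic_on slit_plane"
    by (intro holomorphic_intros) (simp only: slit_plane_iff not_False_eq_True)
  ultimately show "(\<lambda>z. (1 - z) powr (- a) * hyp2F1 a (c - b) c (z / (z - 1))) holomorphic_on slit_plane"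
    by (intro holomorphic_on_mult) (auto simp: comp_def)
  fix z :: complex assume z: "norm z < 1 / 4"
  have "1 - norm z \<le> norm (z - 1)" by (metis norm_minus_commute norm_one norm_triangle_ineq2)
  hence "norm (z / (z - 1)) < 1" "norm z < 1" using z by (auto simp: norm_divide divide_simps)
  thus "hyp2F1 a b c z = (1 - z) powr (- a) * hyp2F1 a (c - b) c (z / (z - 1))"
    by (simp only: hyp2F1_eq_suminf[OF c] Pfaff_near_0[OF c z])
qed simp

lemma hyp2F1_commute: "hyp2F1 a b c = hyp2F1 b a c"
  by (simp add: hyp2F1_def mult.commute)

text \<open>Pfaff's transformation is applied twice, with the upper parameters exchanged in between.
  The map z / (z - 1) is an involution, so the argument returns to z and the exponents -a and c - b
  add up.\<close>

theorem Euler_transformation: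
  assumes c: "c \<notin> \<int>\<^sub>\<le>\<^sub>0" and z: "z \<in> slit_plane"
  shows "hyp2F1 a b c z = (1 - z) powr (c - a - b) * hyp2F1 (c - a) (c - b) c z"
proof -
  let ?w = "z / (z - 1)"
  note w = slit_plane_Pfaff[OF z]
  have ww: "?w / (?w - 1) = z" using w(1) by (simp add: divide_simps)
  have nn: "1 - z \<notin> \<real>\<^sub>\<le>\<^sub>0" using z by (simp only: slit_plane_iff not_False_eq_True)
  have "hyp2F1 a b c z = (1 - z) powr (- a) * hyp2F1 (c - b) a c ?w"
    using Pfaff_transformation[OF c z] hyp2F1_commute by metis
  also have "hyp2F1 (c - b) a c ?w = inverse (1 - z) powr (- (c - b)) * hyp2F1 (c - b) (c - a) c z"
    using Pfaff_transformation[OF c w(3), of "c - b" a] unfolding ww w(2) .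
  \<comment> \<open>Off the branch cut \<open>Ln\<close> of an inverse is the negated logarithm, so
    the exponent changes sign.\<close>
  also have "inverse (1 - z) powr (- (c - b)) = (1 - z) powr (c - b)"
    using w(1) nn by (simp add: powr_def Ln_inverse left_diff_distrib del: complex_nonpos_Reals_iff)
  also have "hyp2F1 (c - b) (c - a) c = hyp2F1 (c - a) (c - b) c" by (rule hyp2F1_commute)
  finally show ?thesis by (simp add: powr_add[symmetric] algebra_simps flip: mult.assoc)
qed

subsection \<open>The integral formulas\<close>

text \<open>In the variable z = 1 - x the kernel integral and the multiple of
  \<open>hyp2F1 A B C\<close> are both holomorphic on the slit plane and agree on the unit disc. It
  remains to match the integrands for u = t / (1 + t).\<close>

theorem hypergeometric_Stieltjes:
  fixes a b c s :: complex and x :: real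
  defines "A \<equiv> a - c + s" and "B \<equiv> b - c + s" and "C \<equiv> a + b - c + s"
  assumes c: "Re c > 0" and A: "Re A > 0" and B: "Re B > 0" and C: "C \<notin> \<int>\<^sub>\<le>\<^sub>0" and x: "x > 0"
  shows "has_bochner_integral lborel
    (\<lambda>t. indicator {0<..} t *\<^sub>R (of_real t powr (c - 1) * hyp2F1 a b c (of_real (- t)) * of_real (x + t) powr (- s)))
    (Gamma c * Gamma A * Gamma B * rGamma s * rGamma C * hyp2F1 A B C (of_real (1 - x)))"
proof -
  note K = half_line.hypergeometric_kernel_integral[of c a s b, folded A_def B_def C_def, OF c A B C]
  have cn: "c \<notin> \<int>\<^sub>\<le>\<^sub>0" using c by (rule Re_pos_notin_nonpos_Ints)
  define g where "g = (\<lambda>z t. of_real (t / (1 + t)) powr (c - 1) * of_real (1 - t / (1 + t)) powr (A - 1) *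
         (\<Sum>n. hyp_coeff a (c - b) c n * of_real (t / (1 + t)) ^ n) * (1 - z * of_real (1 - t / (1 + t))) powr (- s))"
  define k where "k = Gamma c * Gamma A * Gamma B * rGamma s * rGamma C"
  define z where "z = complex_of_real (1 - x)"
  have z: "z \<in> slit_plane" unfolding z_def using x by (intro of_real_in_slit_plane) simp
  have "(\<integral>t. g z t \<partial>half_line) = k * hyp2F1 A B C z"
  proof (rule holomorphic_on_slit_plane_eqI[of "\<lambda>z. \<integral>t. g z t \<partial>half_line" "\<lambda>z. k * hyp2F1 A B C z" 1, OF _ _ _ _ z])
    show "(\<lambda>z. \<integral>t. g z t \<partial>half_line) holomorphic_on slit_plane" using K(1) unfolding g_def .
    show "(\<lambda>z. k * hyp2F1 A B C z) holomorphic_on slit_plane"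
      by (intro holomorphic_intros holomorphic_hyp2F1[OF C])
    show "(\<integral>t. g z t \<partial>half_line) = k * hyp2F1 A B C z" if "norm z < 1" for z
      using K(3)[OF that] hyp2F1_eq_suminf[OF C that] by (simp add: g_def k_def)
  qed simp
  moreover have int: "integrable half_line (g z)" using K(2)[OF z] unfolding g_def .
  moreover have [measurable]: "g z \<in> borel_measurable lborel" using int by (auto simp: half_line_def)
  ultimately have "has_bochner_integral lborel (\<lambda>t. (indicator {0<..} t / (1 + t)\<^sup>2) *\<^sub>R g z t) (k * hyp2F1 A B C z)"
    unfolding half_line_def has_bochner_integral_iff
    by (subst (asm) integral_density, simp, simp, simp, subst (asm) integrable_density) auto
  also have "(\<lambda>t. (indicator {0<..} t / (1 + t)\<^sup>2) *\<^sub>R g z t) =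
    (\<lambda>t. indicator {0<..} t *\<^sub>R (of_real t powr (c - 1) * hyp2F1 a b c (of_real (- t)) * of_real (x + t) powr (- s)))"
  proof
    fix t :: real
    show "(indicator {0<..} t / (1 + t)\<^sup>2) *\<^sub>R g z t =
      indicator {0<..} t *\<^sub>R (of_real t powr (c - 1) * hyp2F1 a b c (of_real (- t)) * of_real (x + t) powr (- s))"
    proof (cases "t > 0")
      case t: True
      define L where "L = 1 + t"
      define u where "u = t / (1 + t)"
      have L: "L > 0" and u: "0 < u" "u < 1" using t by (auto simp: L_def u_def)
      \<comment> \<open>With 1 / L = 1 - u, this q is the base of the kernel power at z = 1 - x, and
        x + t = L q.\<close>
      define q where "q = 1 - (1 - x) * (1 / L)"
      have xq: "x + t = L * q" using L by (simp add: q_def L_def field_simps)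
      have q: "q > 0" using x t L xq by (metis add_pos_pos zero_less_mult_pos)
      have tu: "t = L * u" using L by (simp add: u_def L_def)
      have vL: "1 - u = 1 / L" using t by (simp add: u_def L_def field_simps)
      have powr_mult: "complex_of_real (r * r') powr e = of_real r powr e * of_real r' powr e" if "r > 0" "r' > 0" for r r' e
        using that by (simp add: powr_times_real)
      have t_slit: "complex_of_real (- t) \<in> slit_plane" using t by (intro of_real_in_slit_plane) simp
      have "hyp2F1 a b c (of_real (- t)) = of_real L powr (- a) * hyp2F1 a (c - b) c (of_real u)"
      proof -
        have "complex_of_real (- t) / (of_real (- t) - 1) = of_real ((- t) / (- t - 1))" by simp
        also have "(- t) / (- t - 1) = u" using t by (simp add: u_def divide_simps) (simp add: algebra_simps)
        finally show ?thesis using Pfaff_transformation[OF cn t_slit, of a b] by (simp add: L_def)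
      qed
      also have "hyp2F1 a (c - b) c (of_real u) = (\<Sum>n. hyp_coeff a (c - b) c n * of_real u ^ n)"
        by (rule hyp2F1_eq_suminf[OF cn]) (use u in simp)
      finally have "of_real t powr (c - 1) * hyp2F1 a b c (of_real (- t)) * of_real (x + t) powr (- s) =
        (of_real L powr (c - 1) * of_real L powr (- a) * of_real L powr (- s)) *
        (of_real u powr (c - 1) * (\<Sum>n. hyp_coeff a (c - b) c n * of_real u ^ n) * of_real q powr (- s))"
        unfolding xq powr_mult[OF L q] by (subst tu, subst powr_mult[OF L u(1)]) (simp only: mult_ac)
      \<comment> \<open>The total exponent is c - 1 - a - s = (1 - A) - 2: one part is the power of
        1 - u in the kernel, and L^(-2) is the density of \<open>half_line\<close>.\<close>
      also have "of_real L powr (c - 1) * of_real L powr (- a) * of_real L powr (- s) =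
          of_real (1 / L) powr (A - 1) * of_real (1 / L\<^sup>2)"
      proof -
        have "complex_of_real (1 / L) powr (A - 1) = of_real L powr (1 - A)"
          using L by (simp add: powr_def Ln_of_real ln_div algebra_simps flip: of_real_divide)
        moreover have "complex_of_real (1 / L\<^sup>2) = of_real L powr (- 2)"
          using L by (simp add: powr_minus powr_nat'[of _ 2, simplified] divide_inverse)
        ultimately show ?thesis by (simp add: powr_add[symmetric] A_def algebra_simps)
      qed
      finally have "of_real t powr (c - 1) * hyp2F1 a b c (of_real (- t)) * of_real (x + t) powr (- s) =
         of_real (1 / L\<^sup>2) * g z t"
        unfolding g_def u_def[symmetric] vL q_def z_def by (simp add: mult_ac)
      thus ?thesis using t by (simp add: scaleR_conv_of_real L_def)
    qed auto
  qed
  finally show ?thesis by (simp add: k_def z_def)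
qed

section \<open>From the Stieltjes integral to the two identities\<close>

lemma has_bochner_integral_imp_set_integral:
  assumes "has_bochner_integral M (\<lambda>x. indicator S x *\<^sub>R f x) v"
  shows "set_integrable M S f \<and> (LINT x:S|M. f x) = v"
  using assms by (simp add: set_integrable_def set_lebesgue_integral_def has_bochner_integral_iff)

text \<open>Integrability is asserted next to each value because the Lebesgue integral of a
  non-integrable function defaults to 0. The factors 1/Gamma appear as \<open>rGamma\<close>, which
  is 0 at the poles of Gamma.\<close>

theorem mainTheorem9:
  fixes a b c \<mu> :: complex
  shows
    "(Re (a - c - \<mu> + 1) > 0 \<and> Re (b - c - \<mu> + 1) > 0 \<and> Re c > 0 \<and>
      c \<notin> \<int>\<^sub>\<le>\<^sub>0 \<and> a + b - (c + \<mu>) + 1 \<notin> \<int>\<^sub>\<le>\<^sub>0 \<longrightarrow>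
      (\<forall>x::real \<in> {0<..<1} \<union> {1<..}.
         set_integrable lborel {..<0}
           (\<lambda>y. of_real (- y) powr (c - 1) * w1 y a b c * of_real (x - y) powr (\<mu> - 1)) \<and>
         (LBINT y:{..<0}.
            of_real (- y) powr (c - 1) * w1 y a b c * of_real (x - y) powr (\<mu> - 1)) =
         Gamma (a - c - \<mu> + 1) * Gamma (b - c - \<mu> + 1) * Gamma c *
           rGamma (a + b - c - \<mu> + 1) * rGamma (1 - \<mu>) *
           (of_real x powr (c + \<mu> - 1) * w5 x a b (c + \<mu>))))
     \<and>
     (Re (a - c - \<mu> + 1) > 0 \<and> Re (b - c - \<mu> + 1) > 0 \<and> Re (c - a - b + 1) > 0 \<and>
      c - a - b + 1 \<notin> \<int>\<^sub>\<le>\<^sub>0 \<and> 2 - (c + \<mu>) \<notin> \<int>\<^sub>\<le>\<^sub>0 \<longrightarrow>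
      (\<forall>x::real \<in> {..<0} \<union> {0<..<1}.
         set_integrable lborel {1<..}
           (\<lambda>y. of_real y powr (c - 1) * w6 y a b c * of_real (y - x) powr (\<mu> - 1)) \<and>
         (LBINT y:{1<..}.
            of_real y powr (c - 1) * w6 y a b c * of_real (y - x) powr (\<mu> - 1)) =
         Gamma (a - c - \<mu> + 1) * Gamma (b - c - \<mu> + 1) * Gamma (c - a - b + 1) *
           rGamma (2 - c - \<mu>) * rGamma (1 - \<mu>) *
           (of_real \<bar>x\<bar> powr (c + \<mu> - 1) * w2 x a b (c + \<mu>))))"
proof (intro conjI impI ballI; elim conjE)
  fix x :: real
  define A B C where "A = a - c - \<mu> + 1" and "B = b - c - \<mu> + 1" and "C = a + b - c - \<mu> + 1"
  assume A: "Re (a - c - \<mu> + 1) > 0" and B: "Re (b - c - \<mu> + 1) > 0" and c: "Re c > 0"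
    and C: "a + b - (c + \<mu>) + 1 \<notin> \<int>\<^sub>\<le>\<^sub>0" and x': "x \<in> {0<..<1} \<union> {1<..}"
  from x' have x: "x > 0" by auto
  have eqs: "a - c + (1 - \<mu>) = A" "b - c + (1 - \<mu>) = B" "a + b - c + (1 - \<mu>) = C" "- (1 - \<mu>) = \<mu> - 1"
    "a + b - (c + \<mu>) + 1 = C"
    by (simp_all add: A_def B_def C_def)
  have Cn: "C \<notin> \<int>\<^sub>\<le>\<^sub>0" using C unfolding eqs .
  have "has_bochner_integral lborel
      (\<lambda>t. indicator {0<..} t *\<^sub>R (of_real t powr (c - 1) * hyp2F1 a b c (of_real (- t)) * of_real (x + t) powr (\<mu> - 1)))
      (Gamma c * Gamma A * Gamma B * rGamma (1 - \<mu>) * rGamma C * hyp2F1 A B C (of_real (1 - x)))"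
    using hypergeometric_Stieltjes[of c a "1 - \<mu>" b x, unfolded eqs] A B c Cn x by (simp add: A_def B_def)
  \<comment> \<open>Substitution t = -y.\<close>
  from this[THEN lborel_has_bochner_integral_real_affine_iff[of "-1" _ _ 0, THEN iffD1, rotated]]
  have "has_bochner_integral lborel
      (\<lambda>y. indicator {..<0} y *\<^sub>R (of_real (- y) powr (c - 1) * w1 y a b c * of_real (x - y) powr (\<mu> - 1)))
      (Gamma c * Gamma A * Gamma B * rGamma (1 - \<mu>) * rGamma C * hyp2F1 A B C (of_real (1 - x)))"
    by (simp add: w1_def indicator_def)
  \<comment> \<open>Euler's transformation produces the power of x, since C - A - B = c + \<mu> - 1,
    and turns the upper parameters into b and a.\<close>
  also have "hyp2F1 A B C (of_real (1 - x)) = of_real x powr (c + \<mu> - 1) * w5 x a b (c + \<mu>)"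
  proof -
    have "complex_of_real (1 - x) \<in> slit_plane" using x by (intro of_real_in_slit_plane) simp
    from Euler_transformation[OF Cn this, of A B]
    have "hyp2F1 A B C (of_real (1 - x)) = of_real x powr (C - A - B) * hyp2F1 (C - A) (C - B) C (of_real (1 - x))"
      by simp
    moreover have "C - A - B = c + \<mu> - 1" "C - A = b" "C - B = a" by (simp_all add: A_def B_def C_def)
    ultimately have "hyp2F1 A B C (of_real (1 - x)) = of_real x powr (c + \<mu> - 1) * hyp2F1 b a C (of_real (1 - x))"
      by (simp only:)
    thus ?thesis unfolding w5_def eqs hyp2F1_commute[of a b] .
  qed
  finally have "has_bochner_integral lborel
      (\<lambda>y. indicator {..<0} y *\<^sub>R (of_real (- y) powr (c - 1) * w1 y a b c * of_real (x - y) powr (\<mu> - 1)))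
      (Gamma A * Gamma B * Gamma c * rGamma C * rGamma (1 - \<mu>) * (of_real x powr (c + \<mu> - 1) * w5 x a b (c + \<mu>)))"
    by (simp add: mult_ac)
  note * = has_bochner_integral_imp_set_integral[OF this, unfolded A_def B_def C_def]
  show "set_integrable lborel {..<0}
           (\<lambda>y. of_real (- y) powr (c - 1) * w1 y a b c * of_real (x - y) powr (\<mu> - 1))"
    using * ..
  show "(LBINT y:{..<0}.
            of_real (- y) powr (c - 1) * w1 y a b c * of_real (x - y) powr (\<mu> - 1)) =
         Gamma (a - c - \<mu> + 1) * Gamma (b - c - \<mu> + 1) * Gamma c *
           rGamma (a + b - c - \<mu> + 1) * rGamma (1 - \<mu>) *
           (of_real x powr (c + \<mu> - 1) * w5 x a b (c + \<mu>))"
    using * ..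
next
  fix x :: real
  \<comment> \<open>The Stieltjes formula is used with 1 - a, 1 - b, \<open>c'\<close> and 1 - x for
    a, b, c and x; replacing a by 1 - a exchanges the roles of A and B compared with the first
    identity.\<close>
  define A B C c' where "A = b - c - \<mu> + 1" and "B = a - c - \<mu> + 1" and "C = 2 - c - \<mu>" and "c' = c - a - b + 1"
  assume B: "Re (a - c - \<mu> + 1) > 0" and A: "Re (b - c - \<mu> + 1) > 0" and c: "Re (c - a - b + 1) > 0"
    and C: "2 - (c + \<mu>) \<notin> \<int>\<^sub>\<le>\<^sub>0" and x': "x \<in> {..<0} \<union> {0<..<1}"
  from x' have x: "1 - x > 0" "x \<noteq> 0" by auto
  have eqs: "1 - a - c' + (1 - \<mu>) = A" "1 - b - c' + (1 - \<mu>) = B" "1 - a + (1 - b) - c' + (1 - \<mu>) = C" "- (1 - \<mu>) = \<mu> - 1"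
    "2 - (c + \<mu>) = C" "c' - 1 = c - a - b" "a - (c + \<mu>) + 1 = B" "b - (c + \<mu>) + 1 = A" "1 - (1 - x) = x"
    by (simp_all add: A_def B_def C_def c'_def)
  have Cn: "C \<notin> \<int>\<^sub>\<le>\<^sub>0" using C unfolding eqs .
  have cn: "c' \<notin> \<int>\<^sub>\<le>\<^sub>0" using Re_pos_notin_nonpos_Ints[OF c] unfolding c'_def .
  have "has_bochner_integral lborel
      (\<lambda>t. indicator {0<..} t *\<^sub>R (of_real t powr (c - a - b) * hyp2F1 (1 - a) (1 - b) c' (of_real (- t)) * of_real (1 - x + t) powr (\<mu> - 1)))
      (Gamma c' * Gamma A * Gamma B * rGamma (1 - \<mu>) * rGamma C * hyp2F1 A B C (of_real x))"
    using hypergeometric_Stieltjes[of c' "1 - a" "1 - \<mu>" "1 - b" "1 - x", unfolded eqs] A B c Cn x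
    by (simp add: A_def B_def c'_def)
  \<comment> \<open>Substitution t = y - 1.\<close>
  from this[THEN lborel_has_bochner_integral_real_affine_iff[of 1 _ _ "-1", THEN iffD1, rotated]]
  have "has_bochner_integral lborel
      (\<lambda>y. indicator {0<..} (y - 1) *\<^sub>R (of_real (y - 1) powr (c - a - b) * hyp2F1 (1 - a) (1 - b) c' (of_real (1 - y)) * of_real (y - x) powr (\<mu> - 1)))
      (Gamma c' * Gamma A * Gamma B * rGamma (1 - \<mu>) * rGamma C * hyp2F1 A B C (of_real x))"
    by (simp add: algebra_simps)
  also have "(\<lambda>y. indicator {0<..} (y - 1) *\<^sub>R (of_real (y - 1) powr (c - a - b) * hyp2F1 (1 - a) (1 - b) c' (of_real (1 - y)) * of_real (y - x) powr (\<mu> - 1))) =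
     (\<lambda>y. indicator {1<..} y *\<^sub>R (of_real y powr (c - 1) * w6 y a b c * of_real (y - x) powr (\<mu> - 1)))"
  proof
    fix y :: real
    show "indicator {0<..} (y - 1) *\<^sub>R (of_real (y - 1) powr (c - a - b) * hyp2F1 (1 - a) (1 - b) c' (of_real (1 - y)) * of_real (y - x) powr (\<mu> - 1)) =
      indicator {1<..} y *\<^sub>R (of_real y powr (c - 1) * w6 y a b c * of_real (y - x) powr (\<mu> - 1))"
    proof (cases "y > 1")
      case y: True
      have "complex_of_real (1 - y) \<in> slit_plane" using y by (intro of_real_in_slit_plane) simp
      \<comment> \<open>Euler's transformation extracts y^(1 - c) from \<open>w6\<close>, which
        cancels the factor y^(c - 1) of the integrand.\<close>
      from Euler_transformation[OF cn this, of "c - a" "c - b"]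
      have "hyp2F1 (c - a) (c - b) c' (of_real (1 - y)) = of_real y powr (c' - (c - a) - (c - b)) *
          hyp2F1 (c' - (c - a)) (c' - (c - b)) c' (of_real (1 - y))" by simp
      moreover have "c' - (c - a) - (c - b) = 1 - c" "c' - (c - a) = 1 - b" "c' - (c - b) = 1 - a" by (simp_all add: c'_def)
      ultimately have "hyp2F1 (c - a) (c - b) c' (of_real (1 - y)) = of_real y powr (1 - c) * hyp2F1 (1 - b) (1 - a) c' (of_real (1 - y))"
        by (simp only:)
      hence "w6 y a b c = of_real (y - 1) powr (c - a - b) * (of_real y powr (1 - c) * hyp2F1 (1 - a) (1 - b) c' (of_real (1 - y)))"
        using y by (simp add: w6_def c'_def[symmetric] hyp2F1_commute[of "1 - b"])
      moreover have "complex_of_real y powr (c - 1) * of_real y powr (1 - c) = 1"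
        using y by (simp flip: powr_add)
      ultimately show ?thesis using y by (simp add: mult_ac)
    qed auto
  qed
  \<comment> \<open>The prefactor in \<open>w2\<close> is inverse to the power of |x| in front of
    it, as x is nonzero.\<close>
  also have "hyp2F1 A B C (of_real x) = of_real \<bar>x\<bar> powr (c + \<mu> - 1) * w2 x a b (c + \<mu>)"
  proof -
    have "complex_of_real \<bar>x\<bar> powr (c + \<mu> - 1) * of_real \<bar>x\<bar> powr (1 - (c + \<mu>)) = 1"
      using x by (simp flip: powr_add)
    thus ?thesis unfolding w2_def eqs hyp2F1_commute[of A B] by (simp flip: mult.assoc)
  qed
  finally have "has_bochner_integral lborel
      (\<lambda>y. indicator {1<..} y *\<^sub>R (of_real y powr (c - 1) * w6 y a b c * of_real (y - x) powr (\<mu> - 1)))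
      (Gamma B * Gamma A * Gamma c' * rGamma C * rGamma (1 - \<mu>) * (of_real \<bar>x\<bar> powr (c + \<mu> - 1) * w2 x a b (c + \<mu>)))"
    by (simp add: mult_ac)
  note * = has_bochner_integral_imp_set_integral[OF this, unfolded A_def B_def C_def c'_def]
  show "set_integrable lborel {1<..}
           (\<lambda>y. of_real y powr (c - 1) * w6 y a b c * of_real (y - x) powr (\<mu> - 1))"
    using * ..
  show "(LBINT y:{1<..}.
            of_real y powr (c - 1) * w6 y a b c * of_real (y - x) powr (\<mu> - 1)) =
         Gamma (a - c - \<mu> + 1) * Gamma (b - c - \<mu> + 1) * Gamma (c - a - b + 1) *
           rGamma (2 - c - \<mu>) * rGamma (1 - \<mu>) *
           (of_real \<bar>x\<bar> powr (c + \<mu> - 1) * w2 x a b (c + \<mu>))"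
    using * ..
qed

end
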